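(* Let $u^i_t=f^i(u)_x$, $i=1,2,3$, be a three-component T-system. Then the corresponding congruence of lines $y^i=u^iy^0-f^i(u)$, $i=1,2,3$, in $P^4$ is linear.
   Context: Consider an $n$-component system of conservation laws $u^i_t=f^i(u)_x=v^i_j(u)u^j_x$, $v^i_j=\partial f^i/\partial u^j$, $u=(u^1,\dots,u^n)$, such that the eigenvalues (characteristic velocities) $\lambda^1(u),\dots,\lambda^n(u)$ of $v=(v^i_j)$ are real and pairwise distinct. Let $\xi_i$ be the right eigenvectors, $v\xi_i=\lambda^i\xi_i$, and $L_i=\xi_i^k\,\partial/\partial u^k$. Rarefaction curves of the $i$-th family are the integral curves of $\xi_i$ in $u$-space. The system is a T-system if for every $i$: (a) all rarefaction curves of the $i$-th family are straight lines in the coordinates $u^1,\dots,u^n$; (b) $L_i(\lambda^i)=0$, i.e. $\lambda^i$ is constant along rarefaction curves of the $i$-th family. Considerations are local (near a generic point of $u$-space) with smooth functions. With the system one associates the $n$-parameter family (congruence) of lines $y^i=u^iy^0-f^i(u)$, $i=1,\dots,n$, in projective space $P^{n+1}$ with affine coordinates $y^0,\dots,y^n$. Its Pl\"ucker coordinates are $1,\ u^i,\ f^i,\ u^if^j-u^jf^i$. The congruence is called linear if its Pl\"ucker coordinates satisfy $n$ linearly independent linear equations of the form $$\alpha+\alpha_iu^i+\beta_if^i+\alpha_{ij}(u^if^j-u^jf^i)=0$$ (summation over repeated indices) with constants $\alpha,\alpha_i,\beta_i,\alpha_{ij}$. For $n=3$ this means three such equations, i.e. the image of the congruence in the Grassmannian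 $G(1,4)\subset P^9$ lies in a linear subspace of codimension three. *)

theory Defs
  imports "HOL-Analysis.Analysis"
begin

fun Ck_on :: "nat \<Rightarrow> 'a::real_normed_vector set \<Rightarrow> ('a \<Rightarrow> 'b::real_normed_vector) \<Rightarrow> bool" where
  "Ck_on 0 U f \<longleftrightarrow> continuous_on U f"
| "Ck_on (Suc k) U f \<longleftrightarrow> (\<forall>x\<in>U. f differentiable (at x)) \<and>
     (\<forall>d. Ck_on k U (\<lambda>x. frechet_derivative f (at x) d))"

text \<open>Intended for open \<open>U\<close> in a finite-dimensional space: existence and continuity of all
  iterated directional derivatives is then the usual \<open>C\<^sup>\<infinity>\<close> condition.\<close>

definition smooth_on :: "'a::real_normed_vector set \<Rightarrow> ('a \<Rightarrow> 'b::real_normed_vector) \<Rightarrow> bool" where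
  "smooth_on U f \<longleftrightarrow> (\<forall>k. Ck_on k U f)"

text \<open>The system \<open>u\<^sub>t = f(u)\<^sub>x\<close> enters through its flux \<open>f\<close>; its matrix
  \<open>v\<^sup>i\<^sub>j = \<partial>f\<^sup>i/\<partial>u\<^sup>j\<close> is \<open>jacobian f (at u)\<close>. The velocities \<open>lam i\<close> and the right
  eigenvectors \<open>xi i\<close> are fields on \<open>U\<close>. Since the \<open>CARD('n)\<close> eigenvalues \<open>lam i u\<close> are
  real and distinct, they exhaust the spectrum.\<close>

definition characteristic_fields ::
  "(real^'n) set \<Rightarrow> (real^'n \<Rightarrow> real^'n) \<Rightarrow> ('n \<Rightarrow> real^'n \<Rightarrow> real) \<Rightarrow> ('n \<Rightarrow> real^'n \<Rightarrow> real^'n) \<Rightarrow> bool" where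
  "characteristic_fields U f lam xi \<longleftrightarrow>
     (\<forall>i. smooth_on U (lam i) \<and> smooth_on U (xi i)) \<and>
     (\<forall>u\<in>U. inj (\<lambda>i. lam i u) \<and>
        (\<forall>i. xi i u \<noteq> 0 \<and> jacobian f (at u) *v xi i u = lam i u *\<^sub>R xi i u))"

definition integral_curve_on ::
  "'a::real_normed_vector set \<Rightarrow> ('a \<Rightarrow> 'a) \<Rightarrow> real set \<Rightarrow> (real \<Rightarrow> 'a) \<Rightarrow> bool" where
  "integral_curve_on U X I \<gamma> \<longleftrightarrow> open I \<and> is_interval I \<and>
     (\<forall>t\<in>I. \<gamma> t \<in> U \<and> (\<gamma> has_vector_derivative X (\<gamma> t)) (at t))"

text \<open>A rarefaction curve inside \<open>U\<close> is a connected piece of a straight line iff its image is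
  collinear.\<close>

definition T_system_on :: "(real^'n) set \<Rightarrow> (real^'n \<Rightarrow> real^'n) \<Rightarrow> bool" where
  "T_system_on U f \<longleftrightarrow> smooth_on U f \<and>
     (\<exists>lam xi. characteristic_fields U f lam xi \<and>
        (\<forall>i. (\<forall>I \<gamma>. integral_curve_on U (xi i) I \<gamma> \<longrightarrow> collinear (\<gamma> ` I)) \<and>
             (\<forall>u\<in>U. frechet_derivative (lam i) (at u) (xi i u) = 0)))"

text \<open>Pluecker coordinates \<open>(1, u\<^sup>i, f\<^sup>i, u\<^sup>i f\<^sup>j - u\<^sup>j f\<^sup>i)\<close> of the line
  \<open>y\<^sup>i = u\<^sup>i y\<^sup>0 - f\<^sup>i(u)\<close>: up to sign, the \<open>2 \<times> 2\<close> minors of the homogeneous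
  coordinates \<open>(1 : 0 : -f)\<close> and \<open>(0 : 1 : u)\<close> of its points at \<open>y\<^sup>0 = 0\<close> and at infinity.\<close>

definition plucker_coords ::
  "(real^'n \<Rightarrow> real^'n) \<Rightarrow> real^'n \<Rightarrow> real \<times> (real^'n) \<times> (real^'n) \<times> (real^'n^'n)" where
  "plucker_coords f u = (1, u, f u, \<chi> i j. u $ i * f u $ j - u $ j * f u $ i)"

text \<open>The coordinates \<open>p\<^sup>i\<^sup>j\<close> are stored redundantly as a skew-symmetric matrix, so the
  coefficients \<open>C\<close> are taken skew-symmetric as well; otherwise symmetric \<open>C\<close> would give
  trivial equations that look linearly independent.\<close>

definition linear_congruence_on :: "(real^'n) set \<Rightarrow> (real^'n \<Rightarrow> real^'n) \<Rightarrow> bool" where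
  "linear_congruence_on U f \<longleftrightarrow>
     (\<exists>E :: (real \<times> (real^'n) \<times> (real^'n) \<times> (real^'n^'n)) set.
        independent E \<and> card E = CARD('n) \<and>
        (\<forall>(\<alpha>, a, b, C)\<in>E. transpose C = - C \<and>
           (\<forall>u\<in>U. case plucker_coords f u of (p0, p, q, P) \<Rightarrow>
              \<alpha> * p0 + (\<Sum>i\<in>UNIV. a $ i * p $ i) + (\<Sum>i\<in>UNIV. b $ i * q $ i)
                + (\<Sum>i\<in>UNIV. \<Sum>j\<in>UNIV. C $ i $ j * P $ i $ j) = 0)))"

end

theory Submission
  imports Defs
begin

text \<open>
  Near a point scale the eigenvectors so that \<open>\<xi>\<^sub>i\<close> is constant along its (straight) integral curves
  (existence of integral curves is Picard's theorem). Then \<open>D\<^sup>2f(\<xi>\<^sub>i, \<xi>\<^sub>i) = 0\<close>, so the third derivatives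
  of \<open>f\<close> with a repeated frame argument are combinations of the \<open>D\<^sup>2f(\<xi>\<^sub>i, \<xi>\<^sub>j)\<close>. The key point is that
  the remaining one is too: \<open>D\<^sup>3f(\<xi>\<^sub>1, \<xi>\<^sub>2, \<xi>\<^sub>3)\<close> is the sum over \<open>i < j\<close>, with \<open>k\<close> the third index, of
  \<open>\<xi>\<^sub>k(ln \<bar>\<lambda>\<^sub>i - \<lambda>\<^sub>j\<bar>) D\<^sup>2f(\<xi>\<^sub>i, \<xi>\<^sub>j)\<close>. The \<open>\<xi>\<^sub>3\<close>-component of the difference is a linear first-order
  expression in the \<open>\<xi>\<^sub>3\<close>-component \<open>c\<close> of \<open>D\<^sup>2f(\<xi>\<^sub>1, \<xi>\<^sub>2)\<close>; flatness of \<open>u\<close>-space prescribes the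
  logarithmic derivatives of \<open>c\<close> along \<open>\<xi>\<^sub>1\<close> and \<open>\<xi>\<^sub>2\<close>, and their compatibility says that \<open>c\<close> times
  the difference is \<open>0\<close>.

  The same relation then holds with the Pluecker coordinates \<open>p\<close> in place of \<open>f\<close>. Hence for every
  covector \<open>\<theta>\<close> the second derivative of \<open>\<theta> \<bullet> p\<close> solves a linear homogeneous first-order system, and
  \<open>\<theta> \<bullet> p\<close> vanishes on all of \<open>U\<close> once its 2-jet vanishes at one point. Since \<open>D\<^sup>2p(\<xi>\<^sub>i, \<xi>\<^sub>i) = 0\<close>,
  these are only 7 conditions on the 10-dimensional space of covectors.
\<close>

section \<open>Smooth functions and directional derivatives\<close>

text \<open>The direction precedes the point, so that \<open>dir_deriv g x\<close> is again a
  function of the point and can be differentiated further.\<close>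

definition dir_deriv :: "('a::real_normed_vector \<Rightarrow> 'b::real_normed_vector) \<Rightarrow> 'a \<Rightarrow> 'a \<Rightarrow> 'b" where
  "dir_deriv g x u = frechet_derivative g (at u) x"

lemma dir_deriv_eqI: "(g has_derivative g') (at u) \<Longrightarrow> dir_deriv g x u = g' x"
  unfolding dir_deriv_def by (metis frechet_derivative_at)

lemma has_derivative_dir_deriv:
  "g differentiable (at u) \<Longrightarrow> (g has_derivative (\<lambda>x. dir_deriv g x u)) (at u)"
  unfolding dir_deriv_def by (simp add: frechet_derivative_works eta_contract_eq)

lemma dir_deriv_linear:
  assumes "g differentiable (at u)"
  shows "linear (\<lambda>x. dir_deriv g x u)"
  using has_derivative_dir_deriv[OF assms] has_derivative_linear by blast

lemma dir_deriv_cong: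
  assumes "open V" "u \<in> V" "\<And>v. v \<in> V \<Longrightarrow> g v = h v"
  shows "dir_deriv g x u = dir_deriv h x u"
proof -
  have "(g has_derivative D) (at u) = (h has_derivative D) (at u)" for D
    using has_derivative_transform_within_open[OF _ assms(1,2), of g D UNIV h]
      has_derivative_transform_within_open[OF _ assms(1,2), of h D UNIV g] assms(3) by auto
  then show ?thesis unfolding dir_deriv_def frechet_derivative_def by simp
qed

lemma differentiable_cong_open:
  assumes "open V" "u \<in> V" "\<And>v. v \<in> V \<Longrightarrow> g v = h v" "g differentiable (at u)"
  shows "h differentiable (at u)"
  using assms has_derivative_transform_within_open[OF _ assms(1,2), of g _ UNIV h]
  unfolding differentiable_def by metis

lemma Ck_on_Suc:
  "Ck_on (Suc k) U f \<longleftrightarrow> (\<forall>x\<in>U. f differentiable (at x)) \<and> (\<forall>d. Ck_on k U (dir_deriv f d))"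
  by (simp add: dir_deriv_def[abs_def])

declare Ck_on.simps(2)[simp del]

lemma Ck_on_cong:
  assumes "open V" "\<And>v. v \<in> V \<Longrightarrow> g v = h v" "Ck_on k V g"
  shows "Ck_on k V h"
  using assms(2,3)
proof (induction k arbitrary: g h)
  case 0
  then show ?case using continuous_on_cong[of V V g h] by simp
next
  case (Suc k)
  have "Ck_on k V (dir_deriv h d)" for d
  proof (rule Suc.IH[of "dir_deriv g d"])
    show "dir_deriv g d v = dir_deriv h d v" if "v \<in> V" for v
      using dir_deriv_cong[OF \<open>open V\<close> that] Suc.prems(1) by blast
  qed (use Suc.prems in \<open>simp add: Ck_on_Suc\<close>)
  moreover have "\<forall>x\<in>V. h differentiable (at x)"
    using Suc.prems differentiable_cong_open[OF \<open>open V\<close>, of _ g h] by (auto simp: Ck_on_Suc)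
  ultimately show ?case by (simp add: Ck_on_Suc)
qed

lemma Ck_on_subset: "Ck_on k U g \<Longrightarrow> V \<subseteq> U \<Longrightarrow> Ck_on k V g"
  by (induction k arbitrary: g) (auto simp: Ck_on_Suc intro: continuous_on_subset)

lemma Ck_on_SucD: "Ck_on (Suc k) U g \<Longrightarrow> Ck_on k U g"
proof (induction k arbitrary: g)
  case 0
  then show ?case
    by (auto simp: Ck_on_Suc intro!: differentiable_imp_continuous_on differentiable_at_imp_differentiable_on)
qed (simp add: Ck_on_Suc)

lemma Ck_on_const: "Ck_on k U (\<lambda>u. c)"
proof (induction k arbitrary: c)
  case (Suc k)
  have "dir_deriv (\<lambda>u. c) d = (\<lambda>u. 0)" for d :: 'a
    by (rule ext) (simp add: dir_deriv_eqI[OF has_derivative_const])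
  then show ?case using Suc by (simp add: Ck_on_Suc)
qed simp

lemma dir_deriv_add:
  "g differentiable (at u) \<Longrightarrow> h differentiable (at u) \<Longrightarrow>
    dir_deriv (\<lambda>v. g v + h v) x u = dir_deriv g x u + dir_deriv h x u"
  by (rule dir_deriv_eqI[OF has_derivative_add]) (auto intro: has_derivative_dir_deriv)

lemma dir_deriv_bilinear:
  assumes "bounded_bilinear b" "g differentiable (at u)" "h differentiable (at u)"
  shows "dir_deriv (\<lambda>v. b (g v) (h v)) x u = b (g u) (dir_deriv h x u) + b (dir_deriv g x u) (h u)"
  by (rule dir_deriv_eqI[OF bounded_bilinear.FDERIV[OF assms(1)]])
    (auto intro: has_derivative_dir_deriv assms)

lemma differentiable_bilinear:
  assumes "bounded_bilinear b" "g differentiable (at u)" "h differentiable (at u)"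
  shows "(\<lambda>v. b (g v) (h v)) differentiable (at u)"
  using bounded_bilinear.FDERIV[OF assms(1)] assms(2,3) unfolding differentiable_def by blast

lemma Ck_on_add:
  assumes "open U"
  shows "Ck_on k U g \<Longrightarrow> Ck_on k U h \<Longrightarrow> Ck_on k U (\<lambda>u. g u + h u)"
proof (induction k arbitrary: g h)
  case (Suc k)
  have "Ck_on k U (dir_deriv (\<lambda>u. g u + h u) d)" for d
    by (rule Ck_on_cong[OF assms _ Suc.IH[of "dir_deriv g d" "dir_deriv h d"]])
      (use Suc.prems in \<open>auto simp: Ck_on_Suc dir_deriv_add\<close>)
  then show ?case using Suc.prems by (auto simp: Ck_on_Suc)
qed (auto intro: continuous_on_add)

text \<open>By the Leibniz rule each directional derivative is a sum of two terms of the same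
  bilinear kind, so the induction on \<open>k\<close> closes. Products, scalings, inner products and
  cross products are all instances.\<close>

lemma Ck_on_bilinear:
  assumes "open U" "bounded_bilinear b"
  shows "Ck_on k U g \<Longrightarrow> Ck_on k U h \<Longrightarrow> Ck_on k U (\<lambda>u. b (g u) (h u))"
proof (induction k arbitrary: g h)
  case 0
  then show ?case using bounded_bilinear.continuous_on[OF assms(2)] by auto
next
  case (Suc k)
  have "Ck_on k U g" "Ck_on k U h" using Suc.prems Ck_on_SucD by blast+
  have "Ck_on k U (dir_deriv (\<lambda>u. b (g u) (h u)) d)" for d
    by (rule Ck_on_cong[OF assms(1) _ Ck_on_add[OF assms(1) Suc.IH[of g "dir_deriv h d"]
            Suc.IH[of "dir_deriv g d" h]]])
      (use Suc.prems \<open>Ck_on k U g\<close> \<open>Ck_on k U h\<close> in \<open>auto simp: Ck_on_Suc dir_deriv_bilinear[OF assms(2)]\<close>)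
  then show ?case using Suc.prems by (auto simp: Ck_on_Suc differentiable_bilinear[OF assms(2)])
qed

text \<open>The derivative of 1/g is a product of the derivative of g and two copies of 1/g, and
  these factors are of class \<open>k\<close> by the induction hypothesis.\<close>

lemma Ck_on_inverse:
  fixes g :: "'a::real_normed_vector \<Rightarrow> real"
  assumes "open U" "\<And>u. u \<in> U \<Longrightarrow> g u \<noteq> 0"
  shows "Ck_on k U g \<Longrightarrow> Ck_on k U (\<lambda>u. inverse (g u))"
proof (induction k)
  case 0
  then show ?case using assms(2) by (auto intro!: continuous_on_inverse)
next
  case (Suc k)
  note mult = Ck_on_bilinear[OF assms(1) bounded_bilinear_mult]
  have IH: "Ck_on k U (\<lambda>u. inverse (g u))" using Suc Ck_on_SucD by blast
  have d: "((\<lambda>u. inverse (g u)) has_derivative (\<lambda>x. - (inverse (g u) * dir_deriv g x u * inverse (g u)))) (at u)"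
    if "u \<in> U" for u
    using Suc.prems that assms(2) by (intro Deriv.has_derivative_inverse has_derivative_dir_deriv) (auto simp: Ck_on_Suc)
  have "Ck_on k U (dir_deriv (\<lambda>u. inverse (g u)) d)" for d
    by (rule Ck_on_cong[OF assms(1) _ mult[OF mult[OF mult[OF Ck_on_const[of k U "-1"] IH], of "dir_deriv g d"] IH]])
      (use Suc.prems in \<open>auto simp: Ck_on_Suc dir_deriv_eqI[OF d]\<close>)
  then show ?case using Suc.prems d unfolding Ck_on_Suc differentiable_def by blast
qed

lemma smooth_on_Ck: "smooth_on U g \<Longrightarrow> Ck_on k U g"
  by (simp add: smooth_on_def)

lemma smooth_on_differentiable: "smooth_on U g \<Longrightarrow> u \<in> U \<Longrightarrow> g differentiable (at u)"
  using smooth_on_Ck[of U g "Suc 0"] by (simp add: Ck_on_Suc)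

lemma smooth_on_dir_deriv: "smooth_on U g \<Longrightarrow> smooth_on U (dir_deriv g d)"
  unfolding smooth_on_def by (rule allI, drule_tac x="Suc k" in spec) (simp add: Ck_on_Suc)

lemma smooth_on_continuous_on: "smooth_on U g \<Longrightarrow> continuous_on U g"
  using smooth_on_Ck[of U g 0] by simp

lemma smooth_on_subset: "smooth_on U g \<Longrightarrow> V \<subseteq> U \<Longrightarrow> smooth_on V g"
  unfolding smooth_on_def by (blast intro: Ck_on_subset)

lemma smooth_on_cong: "open V \<Longrightarrow> (\<And>v. v \<in> V \<Longrightarrow> g v = h v) \<Longrightarrow> smooth_on V g \<Longrightarrow> smooth_on V h"
  unfolding smooth_on_def by (blast intro: Ck_on_cong[of V g h])

lemma smooth_on_const: "smooth_on U (\<lambda>u. c)"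
  by (simp add: smooth_on_def Ck_on_const)

lemma smooth_on_ident: "smooth_on U (\<lambda>u. u)"
proof -
  have "dir_deriv (\<lambda>u. u) d = (\<lambda>u. d)" for d :: 'a
    by (rule ext) (simp add: dir_deriv_eqI[OF has_derivative_ident])
  then have "Ck_on k U (\<lambda>u. u)" for k
    by (cases k) (simp_all add: Ck_on_Suc Ck_on_const)
  then show ?thesis by (simp add: smooth_on_def)
qed

lemma smooth_on_add: "open U \<Longrightarrow> smooth_on U g \<Longrightarrow> smooth_on U h \<Longrightarrow> smooth_on U (\<lambda>u. g u + h u)"
  by (simp add: smooth_on_def Ck_on_add)

lemma smooth_on_bilinear:
  "bounded_bilinear b \<Longrightarrow> open U \<Longrightarrow> smooth_on U g \<Longrightarrow> smooth_on U h \<Longrightarrow> smooth_on U (\<lambda>u. b (g u) (h u))"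
  unfolding smooth_on_def by (rule allI, rule Ck_on_bilinear) auto

lemmas smooth_on_mult = smooth_on_bilinear[OF bounded_bilinear_mult]
lemmas smooth_on_scaleR = smooth_on_bilinear[OF bounded_bilinear_scaleR]
lemmas smooth_on_inner = smooth_on_bilinear[OF bounded_bilinear_inner]

lemma smooth_on_linear:
  assumes "bounded_linear l" "open U" "smooth_on U g"
  shows "smooth_on U (\<lambda>u. l (g u))"
proof -
  \<comment> \<open>A linear map is treated as a bilinear one whose scalar argument is the constant
    1.\<close>
  have "bounded_bilinear (\<lambda>(a::real) x. a *\<^sub>R l x)"
    using bounded_bilinear.comp[OF bounded_bilinear_scaleR bounded_linear_ident assms(1)] .
  from smooth_on_bilinear[OF this assms(2) smooth_on_const[of U 1] assms(3)] show ?thesis by simp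
qed

lemma smooth_on_inverse:
  fixes g :: "'a::real_normed_vector \<Rightarrow> real"
  shows "open U \<Longrightarrow> smooth_on U g \<Longrightarrow> (\<And>u. u \<in> U \<Longrightarrow> g u \<noteq> 0) \<Longrightarrow> smooth_on U (\<lambda>u. inverse (g u))"
  unfolding smooth_on_def by (intro allI Ck_on_inverse) auto

lemma smooth_on_divide:
  fixes g :: "'a::real_normed_vector \<Rightarrow> real"
  shows "open U \<Longrightarrow> smooth_on U h \<Longrightarrow> smooth_on U g \<Longrightarrow> (\<And>u. u \<in> U \<Longrightarrow> g u \<noteq> 0) \<Longrightarrow>
    smooth_on U (\<lambda>u. h u / g u)"
  unfolding divide_inverse by (simp add: smooth_on_mult smooth_on_inverse)

lemma smooth_on_minus: "open U \<Longrightarrow> smooth_on U g \<Longrightarrow> smooth_on U (\<lambda>u. - g u)"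
  using smooth_on_linear[OF bounded_linear_minus[OF bounded_linear_ident], of U g] by simp

lemma smooth_on_diff: "open U \<Longrightarrow> smooth_on U g \<Longrightarrow> smooth_on U h \<Longrightarrow> smooth_on U (\<lambda>u. g u - h u)"
  using smooth_on_add[of U g "\<lambda>u. - h u"] smooth_on_minus[of U h] by simp

lemma smooth_on_sum:
  "open U \<Longrightarrow> (\<And>i. i \<in> A \<Longrightarrow> smooth_on U (g i)) \<Longrightarrow> smooth_on U (\<lambda>u. \<Sum>i\<in>A. g i u)"
  by (induction A rule: infinite_finite_induct) (simp_all add: smooth_on_const smooth_on_add)

lemma smooth_on_vec_nth: "open U \<Longrightarrow> smooth_on U g \<Longrightarrow> smooth_on U (\<lambda>u. g u $ i)"
  by (rule smooth_on_linear[OF bounded_linear_vec_nth])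

lemma dir_deriv_linear_comp:
  assumes "bounded_linear l" "g differentiable (at u)"
  shows "dir_deriv (\<lambda>v. l (g v)) x u = l (dir_deriv g x u)"
  by (rule dir_deriv_eqI[OF bounded_linear.has_derivative[OF assms(1) has_derivative_dir_deriv[OF assms(2)]]])

section \<open>Symmetry of second derivatives\<close>

text \<open>The mean value theorem is applied twice: in direction \<open>x\<close> to the difference
  of two translates of \<open>g\<close>, then in direction \<open>y\<close> to
  \<open>dir_deriv g x\<close>. The second difference on the left is symmetric in \<open>x\<close>
  and \<open>y\<close>.\<close>

lemma second_difference_mvt:
  fixes g :: "'a::real_normed_vector \<Rightarrow> real"
  assumes "0 < h" and g: "smooth_on U g"
    and U: "\<And>s t. \<lbrakk>0 \<le> s; s \<le> h; 0 \<le> t; t \<le> h\<rbrakk> \<Longrightarrow> u + s *\<^sub>R x + t *\<^sub>R y \<in> U"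
  shows "\<exists>s t. 0 \<le> s \<and> s \<le> h \<and> 0 \<le> t \<and> t \<le> h \<and>
    g (u + h *\<^sub>R x + h *\<^sub>R y) - g (u + h *\<^sub>R x) - g (u + h *\<^sub>R y) + g u
      = h * h * dir_deriv (dir_deriv g x) y (u + s *\<^sub>R x + t *\<^sub>R y)"
proof -
  have line: "((\<lambda>s. k (a + s *\<^sub>R d)) has_real_derivative dir_deriv k d (a + s *\<^sub>R d)) (at s)"
    if "smooth_on U k" "a + s *\<^sub>R d \<in> U" for k :: "'a \<Rightarrow> real" and a d s
  proof -
    have "((\<lambda>s. a + s *\<^sub>R d) has_derivative (\<lambda>t. t *\<^sub>R d)) (at s)"
      by (auto intro!: derivative_eq_intros)
    from has_derivative_compose[OF this has_derivative_dir_deriv[OF smooth_on_differentiable[OF that]]]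
    have "((\<lambda>s. k (a + s *\<^sub>R d)) has_derivative (\<lambda>t. dir_deriv k (t *\<^sub>R d) (a + s *\<^sub>R d))) (at s)" .
    moreover have "dir_deriv k (t *\<^sub>R d) (a + s *\<^sub>R d) = dir_deriv k d (a + s *\<^sub>R d) * t" for t
      using linear_cmul[OF dir_deriv_linear[OF smooth_on_differentiable[OF that]]] by simp
    ultimately show ?thesis by (simp add: has_field_derivative_def)
  qed
  have 1: "((\<lambda>s. g ((u + h *\<^sub>R y) + s *\<^sub>R x) - g (u + s *\<^sub>R x)) has_real_derivative
      dir_deriv g x ((u + h *\<^sub>R y) + s *\<^sub>R x) - dir_deriv g x (u + s *\<^sub>R x)) (at s)"
    if "0 \<le> s" "s \<le> h" for s
    using U[of s h] U[of s 0] that \<open>0 < h\<close>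
    by (intro DERIV_diff line g) (simp_all add: algebra_simps)
  obtain s where s: "0 < s" "s < h"
    and s': "(g ((u + h *\<^sub>R y) + h *\<^sub>R x) - g (u + h *\<^sub>R x)) - (g ((u + h *\<^sub>R y) + 0 *\<^sub>R x) - g (u + 0 *\<^sub>R x))
      = (h - 0) * (dir_deriv g x ((u + h *\<^sub>R y) + s *\<^sub>R x) - dir_deriv g x (u + s *\<^sub>R x))"
    using MVT2[OF \<open>0 < h\<close> 1] by blast
  have 2: "((\<lambda>t. dir_deriv g x ((u + s *\<^sub>R x) + t *\<^sub>R y)) has_real_derivative
      dir_deriv (dir_deriv g x) y ((u + s *\<^sub>R x) + t *\<^sub>R y)) (at t)"
    if "0 \<le> t" "t \<le> h" for t
    using U[of s t] that s by (intro line smooth_on_dir_deriv g) simp_all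
  obtain t where t: "0 < t" "t < h"
    and t': "dir_deriv g x ((u + s *\<^sub>R x) + h *\<^sub>R y) - dir_deriv g x ((u + s *\<^sub>R x) + 0 *\<^sub>R y)
      = (h - 0) * dir_deriv (dir_deriv g x) y ((u + s *\<^sub>R x) + t *\<^sub>R y)"
    using MVT2[OF \<open>0 < h\<close> 2] by blast
  show ?thesis
    by (rule exI[of _ s], rule exI[of _ t]) (use s s' t t' in \<open>simp add: algebra_simps\<close>)
qed

text \<open>Schwarz's theorem: the two mixed derivatives share a value at points arbitrarily near
  \<open>u\<close>, namely the second difference divided by \<open>h * h\<close>, and continuity
  then excludes different values at \<open>u\<close>.\<close>

lemma dir_deriv_commute_real:
  fixes g :: "'a::real_normed_vector \<Rightarrow> real"
  assumes "open U" "u \<in> U" and g: "smooth_on U g"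
  shows "dir_deriv (dir_deriv g x) y u = dir_deriv (dir_deriv g y) x u"
proof (rule ccontr)
  let ?a = "dir_deriv (dir_deriv g x) y" and ?b = "dir_deriv (dir_deriv g y) x"
  assume ne: "?a u \<noteq> ?b u"
  define e where "e = dist (?a u) (?b u) / 2"
  have "e > 0" using ne by (simp add: e_def)
  have "continuous_on U ?a" "continuous_on U ?b"
    by (auto intro!: smooth_on_continuous_on smooth_on_dir_deriv g)
  then have "isCont ?a u" "isCont ?b u"
    using assms(1,2) continuous_on_eq_continuous_at by blast+
  then have "(?a \<longlongrightarrow> ?a u) (nhds u)" "(?b \<longlongrightarrow> ?b u) (nhds u)"
    by (simp_all add: isCont_def tendsto_at_iff_tendsto_nhds)
  then have "\<forall>\<^sub>F v in nhds u. dist (?a v) (?a u) < e \<and> dist (?b v) (?b u) < e \<and> v \<in> U"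
    using \<open>e > 0\<close> eventually_nhds_in_open[OF assms(1,2)] by (auto intro!: eventually_conj tendstoD)
  then obtain r where r: "r > 0" "\<And>v. dist v u < r \<Longrightarrow> dist (?a v) (?a u) < e \<and> dist (?b v) (?b u) < e \<and> v \<in> U"
    by (auto simp: eventually_nhds_metric)
  \<comment> \<open>With this side length the parallelogram spanned by \<open>h *\<^sub>R x\<close>
    and \<open>h *\<^sub>R y\<close> lies in the ball of radius \<open>r\<close>; the summand 1
    keeps the denominator positive when \<open>x\<close> and \<open>y\<close> vanish.\<close>
  define h where "h = r / (norm x + norm y + 1)"
  have np: "norm x + norm y + 1 > 0" by (smt (verit) norm_ge_zero)
  then have "h > 0" using r by (simp add: h_def)
  have near: "dist (u + s *\<^sub>R x + t *\<^sub>R y) u < r" if "0 \<le> s" "s \<le> h" "0 \<le> t" "t \<le> h" for s t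
  proof -
    have "dist (u + s *\<^sub>R x + t *\<^sub>R y) u = norm (s *\<^sub>R x + t *\<^sub>R y)" by (simp add: dist_norm)
    also have "\<dots> \<le> s * norm x + t * norm y"
      using norm_triangle_ineq[of "s *\<^sub>R x" "t *\<^sub>R y"] that by simp
    also have "\<dots> \<le> h * norm x + h * norm y"
      using that by (intro add_mono mult_right_mono) auto
    also have "\<dots> < h * (norm x + norm y + 1)" using \<open>h > 0\<close> by (simp add: algebra_simps)
    also have "\<dots> = r" using np by (simp add: h_def)
    finally show ?thesis .
  qed
  have near': "dist (u + s *\<^sub>R y + t *\<^sub>R x) u < r" if "0 \<le> s" "s \<le> h" "0 \<le> t" "t \<le> h" for s t
    using near[OF that(3,4,1,2)] by (simp add: algebra_simps)
  obtain s t where 1: "dist (u + s *\<^sub>R x + t *\<^sub>R y) u < r"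
    "g (u + h *\<^sub>R x + h *\<^sub>R y) - g (u + h *\<^sub>R x) - g (u + h *\<^sub>R y) + g u = h * h * ?a (u + s *\<^sub>R x + t *\<^sub>R y)"
    using second_difference_mvt[OF \<open>h > 0\<close> g, of u x y] near r(2) by blast
  obtain s' t' where 2: "dist (u + s' *\<^sub>R y + t' *\<^sub>R x) u < r"
    "g (u + h *\<^sub>R y + h *\<^sub>R x) - g (u + h *\<^sub>R y) - g (u + h *\<^sub>R x) + g u = h * h * ?b (u + s' *\<^sub>R y + t' *\<^sub>R x)"
    using second_difference_mvt[OF \<open>h > 0\<close> g, of u y x] near' r(2) by blast
  have "h * h * ?a (u + s *\<^sub>R x + t *\<^sub>R y) = h * h * ?b (u + s' *\<^sub>R y + t' *\<^sub>R x)"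
    using 1(2) 2(2) by (simp add: algebra_simps)
  then have "?a (u + s *\<^sub>R x + t *\<^sub>R y) = ?b (u + s' *\<^sub>R y + t' *\<^sub>R x)"
    using \<open>h > 0\<close> by simp
  then show False
    using r(2)[OF 1(1)] r(2)[OF 2(1)] dist_triangle2[of "?a u" "?b u" "?b (u + s' *\<^sub>R y + t' *\<^sub>R x)"]
    by (simp add: e_def dist_commute field_simps)
qed

lemma dir_deriv_commute:
  fixes g :: "'a::real_normed_vector \<Rightarrow> 'b::euclidean_space"
  assumes "open U" "u \<in> U" and g: "smooth_on U g"
  shows "dir_deriv (dir_deriv g x) y u = dir_deriv (dir_deriv g y) x u"
proof (rule euclidean_eqI)
  fix b :: 'b assume "b \<in> Basis"
  note bl = bounded_linear_inner_left[of b]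
  have gb: "smooth_on U (\<lambda>v. g v \<bullet> b)" by (rule smooth_on_linear[OF bl \<open>open U\<close> g])
  have "dir_deriv (dir_deriv (\<lambda>v. g v \<bullet> b) z) w u = dir_deriv (dir_deriv g z) w u \<bullet> b" for z w
    using dir_deriv_cong[OF assms(1,2), of "dir_deriv (\<lambda>v. g v \<bullet> b) z" "\<lambda>v. dir_deriv g z v \<bullet> b" w]
      dir_deriv_linear_comp[OF bl smooth_on_differentiable[OF g]]
      dir_deriv_linear_comp[OF bl smooth_on_differentiable[OF smooth_on_dir_deriv[OF g] \<open>u \<in> U\<close>]]
    by simp
  then show "dir_deriv (dir_deriv g x) y u \<bullet> b = dir_deriv (dir_deriv g y) x u \<bullet> b"
    using dir_deriv_commute_real[OF assms(1,2) gb, of x y] by simp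
qed

section \<open>Differentiation along vector fields\<close>

text \<open>A product rule for a direction that varies with the point: expanding the direction in
  the standard basis turns \<open>h (X v) v\<close> into a finite sum of coordinates of
  \<open>X\<close> times fixed smooth functions.\<close>

lemma dir_deriv_family:
  fixes h :: "'a::euclidean_space \<Rightarrow> 'a \<Rightarrow> 'b::real_normed_vector"
  assumes "open U" "u \<in> U" and lin: "\<And>v. v \<in> U \<Longrightarrow> linear (\<lambda>x. h x v)"
    and h: "\<And>x. smooth_on U (h x)" and X: "smooth_on U X"
  shows "dir_deriv (\<lambda>v. h (X v) v) z u = dir_deriv (h (X u)) z u + h (dir_deriv X z u) u"
    and "smooth_on U (\<lambda>v. h (X v) v)"
    and "linear (\<lambda>x. dir_deriv (h x) z u)"
proof -
  have expand: "h x v = (\<Sum>b\<in>Basis. (x \<bullet> b) *\<^sub>R h b v)" if "v \<in> U" for x v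
  proof -
    have "h x v = h (\<Sum>b\<in>Basis. (x \<bullet> b) *\<^sub>R b) v" by (simp add: euclidean_representation)
    also have "\<dots> = (\<Sum>b\<in>Basis. (x \<bullet> b) *\<^sub>R h b v)"
      by (simp only: linear_sum[OF lin[OF that]] linear_cmul[OF lin[OF that]])
    finally show ?thesis .
  qed
  have Xb: "smooth_on U (\<lambda>v. X v \<bullet> b)" for b
    by (rule smooth_on_inner[OF \<open>open U\<close> X smooth_on_const])
  have der: "((\<lambda>v. \<Sum>b\<in>Basis. a b v *\<^sub>R h b v) has_derivative
      (\<lambda>z. \<Sum>b\<in>Basis. a b u *\<^sub>R dir_deriv (h b) z u + dir_deriv (a b) z u *\<^sub>R h b u)) (at u)"
    if "\<And>b. smooth_on U (a b)" for a :: "'a \<Rightarrow> 'a \<Rightarrow> real"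
    by (intro has_derivative_sum has_derivative_scaleR has_derivative_dir_deriv
        smooth_on_differentiable[OF _ \<open>u \<in> U\<close>] that h)
  have hx: "dir_deriv (h x) z u = (\<Sum>b\<in>Basis. (x \<bullet> b) *\<^sub>R dir_deriv (h b) z u)" for x z
  proof -
    have "dir_deriv (h x) z u = dir_deriv (\<lambda>v. \<Sum>b\<in>Basis. (x \<bullet> b) *\<^sub>R h b v) z u"
      using dir_deriv_cong[OF assms(1,2) expand] .
    also have "\<dots> = (\<Sum>b\<in>Basis. (x \<bullet> b) *\<^sub>R dir_deriv (h b) z u)"
      using dir_deriv_eqI[OF der[of "\<lambda>b v. x \<bullet> b"], where x = z]
      by (simp add: smooth_on_const dir_deriv_eqI[OF has_derivative_const])
    finally show ?thesis .
  qed
  show "linear (\<lambda>x. dir_deriv (h x) z u)"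
  proof (rule linearI)
    fix x y c
    show "dir_deriv (h (x + y)) z u = dir_deriv (h x) z u + dir_deriv (h y) z u"
      by (simp add: hx[of "x + y"] hx[of x] hx[of y] inner_add_left scaleR_add_left sum.distrib)
    show "dir_deriv (h (c *\<^sub>R x)) z u = c *\<^sub>R dir_deriv (h x) z u"
      by (simp add: hx[of "c *\<^sub>R x"] hx[of x] scaleR_sum_right)
  qed
  have dXb: "dir_deriv (\<lambda>v. X v \<bullet> b) z u = dir_deriv X z u \<bullet> b" for b z
    by (rule dir_deriv_linear_comp[OF bounded_linear_inner_left smooth_on_differentiable[OF X \<open>u \<in> U\<close>]])
  have "dir_deriv (\<lambda>v. h (X v) v) z u = dir_deriv (\<lambda>v. \<Sum>b\<in>Basis. (X v \<bullet> b) *\<^sub>R h b v) z u"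
    using dir_deriv_cong[OF assms(1,2) expand] .
  also have "\<dots> = (\<Sum>b\<in>Basis. (X u \<bullet> b) *\<^sub>R dir_deriv (h b) z u + (dir_deriv X z u \<bullet> b) *\<^sub>R h b u)"
    using dir_deriv_eqI[OF der[OF Xb], where x = z] by (simp add: dXb)
  also have "\<dots> = dir_deriv (h (X u)) z u + h (dir_deriv X z u) u"
    by (simp add: hx[of "X u"] expand[OF \<open>u \<in> U\<close>, of "dir_deriv X z u"] sum.distrib)
  finally show "dir_deriv (\<lambda>v. h (X v) v) z u = dir_deriv (h (X u)) z u + h (dir_deriv X z u) u" .
  show "smooth_on U (\<lambda>v. h (X v) v)"
  proof (rule smooth_on_cong[OF \<open>open U\<close>])
    show "(\<Sum>b\<in>Basis. (X v \<bullet> b) *\<^sub>R h b v) = h (X v) v" if "v \<in> U" for v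
      by (rule expand[OF that, symmetric])
    show "smooth_on U (\<lambda>v. \<Sum>b\<in>Basis. (X v \<bullet> b) *\<^sub>R h b v)"
      by (rule smooth_on_sum[OF \<open>open U\<close> smooth_on_scaleR[OF \<open>open U\<close> Xb h]])
  qed
qed

context
  fixes U :: "'a::euclidean_space set" and g :: "'a \<Rightarrow> 'b::euclidean_space"
  assumes U: "open U" and g: "smooth_on U g"
begin

lemma linear_dir_deriv1: "u \<in> U \<Longrightarrow> linear (\<lambda>x. dir_deriv g x u)"
  by (rule dir_deriv_linear[OF smooth_on_differentiable[OF g]])

lemma linear_dir_deriv2: "u \<in> U \<Longrightarrow> linear (\<lambda>x. dir_deriv (dir_deriv g x) y u)"
  by (rule dir_deriv_family(3)[OF U _ linear_dir_deriv1 smooth_on_dir_deriv[OF g] smooth_on_ident])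

lemma linear_dir_deriv2': "u \<in> U \<Longrightarrow> linear (\<lambda>y. dir_deriv (dir_deriv g x) y u)"
  by (rule dir_deriv_linear[OF smooth_on_differentiable[OF smooth_on_dir_deriv[OF g]]])

lemma dir_deriv_field:
  assumes "u \<in> U" "smooth_on U X"
  shows "dir_deriv (\<lambda>v. dir_deriv g (X v) v) z u
    = dir_deriv (dir_deriv g (X u)) z u + dir_deriv g (dir_deriv X z u) u"
  by (rule dir_deriv_family(1)[OF U \<open>u \<in> U\<close> linear_dir_deriv1 smooth_on_dir_deriv[OF g] assms(2)])

lemma smooth_on_field: "smooth_on U X \<Longrightarrow> smooth_on U (\<lambda>v. dir_deriv g (X v) v)"
  \<comment> \<open>The second fact covers empty \<open>U\<close>, where no point is available for
    \<open>dir_deriv_family\<close>.\<close>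
  using dir_deriv_family(2)[OF U _ linear_dir_deriv1 smooth_on_dir_deriv[OF g], of _ X]
    smooth_on_cong[OF U _ smooth_on_const[of U 0], of "\<lambda>v. dir_deriv g (X v) v"]
  by blast

lemma dir_deriv_field2:
  assumes u: "u \<in> U" and X: "smooth_on U X" and Y: "smooth_on U Y"
  shows "dir_deriv (\<lambda>v. dir_deriv (dir_deriv g (X v)) (Y v) v) z u
    = dir_deriv (dir_deriv (dir_deriv g (X u)) (Y u)) z u
      + dir_deriv (dir_deriv g (dir_deriv X z u)) (Y u) u + dir_deriv (dir_deriv g (X u)) (dir_deriv Y z u) u"
    and "smooth_on U (\<lambda>v. dir_deriv (dir_deriv g (X v)) (Y v) v)"
proof -
  note sm = smooth_on_dir_deriv[OF smooth_on_dir_deriv[OF g]]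
  note 1 = dir_deriv_family[OF U u linear_dir_deriv2 sm X]
  have lin: "linear (\<lambda>y. dir_deriv (dir_deriv g (X v)) y v)" if "v \<in> U" for v
    by (rule linear_dir_deriv2'[OF that])
  show "dir_deriv (\<lambda>v. dir_deriv (dir_deriv g (X v)) (Y v) v) z u
    = dir_deriv (dir_deriv (dir_deriv g (X u)) (Y u)) z u
      + dir_deriv (dir_deriv g (dir_deriv X z u)) (Y u) u + dir_deriv (dir_deriv g (X u)) (dir_deriv Y z u) u"
    using dir_deriv_family(1)[OF U u lin 1(2) Y] 1(1) by simp
  show "smooth_on U (\<lambda>v. dir_deriv (dir_deriv g (X v)) (Y v) v)"
    by (rule dir_deriv_family(2)[OF U u lin 1(2) Y])
qed

end

text \<open>For a vector field \<open>g\<close> this is the flat covariant derivative of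
  \<open>g\<close> along \<open>X\<close>, not the Lie bracket.\<close>

definition along :: "('a::real_normed_vector \<Rightarrow> 'a) \<Rightarrow> ('a \<Rightarrow> 'b::real_normed_vector) \<Rightarrow> 'a \<Rightarrow> 'b" where
  "along X g u = dir_deriv g (X u) u"

lemma along_cong: "open U \<Longrightarrow> u \<in> U \<Longrightarrow> (\<And>v. v \<in> U \<Longrightarrow> g v = h v) \<Longrightarrow> along X g u = along X h u"
  unfolding along_def by (rule dir_deriv_cong)

lemma smooth_on_along:
  fixes g :: "'a::euclidean_space \<Rightarrow> 'b::euclidean_space"
  shows "open U \<Longrightarrow> smooth_on U X \<Longrightarrow> smooth_on U g \<Longrightarrow> smooth_on U (along X g)"
  unfolding along_def[abs_def] by (rule smooth_on_field)

lemma along_const: "along X (\<lambda>v. c) u = 0"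
  by (simp add: along_def dir_deriv_eqI[OF has_derivative_const])

lemma along_bilinear:
  assumes "bounded_bilinear b" "u \<in> U" "smooth_on U g" "smooth_on U h"
  shows "along X (\<lambda>v. b (g v) (h v)) u = b (g u) (along X h u) + b (along X g u) (h u)"
  unfolding along_def
  by (rule dir_deriv_bilinear[OF assms(1) smooth_on_differentiable[OF assms(3,2)] smooth_on_differentiable[OF assms(4,2)]])

lemmas along_mult = along_bilinear[OF bounded_bilinear_mult]
lemmas along_scaleR = along_bilinear[OF bounded_bilinear_scaleR]

lemma along_diff:
  assumes "u \<in> U" "smooth_on U g" "smooth_on U h"
  shows "along X (\<lambda>v. g v - h v) u = along X g u - along X h u"
  unfolding along_def
  by (rule dir_deriv_eqI) (intro has_derivative_diff has_derivative_dir_deriv smooth_on_differentiable[OF _ \<open>u \<in> U\<close>] assms)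

lemma along_sum:
  assumes "u \<in> U" "\<And>i. i \<in> A \<Longrightarrow> smooth_on U (g i)"
  shows "along X (\<lambda>v. \<Sum>i\<in>A. g i v) u = (\<Sum>i\<in>A. along X (g i) u)"
  unfolding along_def
  by (rule dir_deriv_eqI)
    (intro has_derivative_sum has_derivative_dir_deriv smooth_on_differentiable[OF _ \<open>u \<in> U\<close>] assms)

text \<open>The second derivatives of \<open>g\<close> cancel by symmetry; what remains is the
  derivative along the Lie bracket of \<open>X\<close> and \<open>Y\<close>.\<close>

lemma along_commutator:
  fixes g :: "'a::euclidean_space \<Rightarrow> 'b::euclidean_space"
  assumes U: "open U" and u: "u \<in> U" and X: "smooth_on U X" and Y: "smooth_on U Y" and g: "smooth_on U g"
  shows "along X (along Y g) u - along Y (along X g) u = dir_deriv g (along X Y u - along Y X u) u"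
  unfolding along_def[abs_def] dir_deriv_field[OF U g u X] dir_deriv_field[OF U g u Y]
    linear_diff[OF linear_dir_deriv1[OF U g u]] dir_deriv_commute[OF U u g, of "X u"] by simp

section \<open>The moving frame of a T-system\<close>

text \<open>Allows identities to be proved for arbitrary distinct \<open>i\<close>,
  \<open>j\<close>, \<open>k\<close>, so that other labellings follow by renaming.\<close>

lemma sum_3_distinct:
  fixes i j k :: 3
  assumes "i \<noteq> j" "i \<noteq> k" "j \<noteq> k"
  shows "(\<Sum>n\<in>UNIV. g n) = g i + g j + g k"
proof -
  have "card {i, j, k} = 3" using assms by simp
  then have "UNIV = {i, j, k}" using card_seteq[of UNIV "{i, j, k}"] by simp
  then have "sum g UNIV = sum g {i, j, k}" by simp
  also have "\<dots> = g i + g j + g k" using assms by (simp add: add.assoc)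
  finally show ?thesis .
qed

text \<open>The local situation after normalisation: \<open>\<omega>\<close> is the coframe dual to
  the eigenvectors, and \<open>straight\<close> records that these are scaled to be constant along
  their own rarefaction curves.\<close>

locale T_frame =
  fixes V :: "(real^3) set" and f :: "real^3 \<Rightarrow> real^3"
    and lam :: "3 \<Rightarrow> real^3 \<Rightarrow> real" and \<xi> \<omega> :: "3 \<Rightarrow> real^3 \<Rightarrow> real^3"
  assumes V: "open V"
    and smooth_f: "smooth_on V f" and smooth_lam: "smooth_on V (lam i)"
    and smooth_xi: "smooth_on V (\<xi> i)" and smooth_omega: "smooth_on V (\<omega> i)"
    and dual: "u \<in> V \<Longrightarrow> \<omega> k u \<bullet> \<xi> i u = (if k = i then 1 else 0)"
    and expand: "u \<in> V \<Longrightarrow> x = (\<Sum>k\<in>UNIV. (\<omega> k u \<bullet> x) *\<^sub>R \<xi> k u)"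
    and eigen: "u \<in> V \<Longrightarrow> dir_deriv f (\<xi> i u) u = lam i u *\<^sub>R \<xi> i u"
    and distinct: "u \<in> V \<Longrightarrow> i \<noteq> j \<Longrightarrow> lam i u \<noteq> lam j u"
    and lam_const: "u \<in> V \<Longrightarrow> along (\<xi> i) (lam i) u = 0"
    and straight: "u \<in> V \<Longrightarrow> along (\<xi> i) (\<xi> i) u = 0"
begin

abbreviation D :: "3 \<Rightarrow> (real^3 \<Rightarrow> 'b::real_normed_vector) \<Rightarrow> real^3 \<Rightarrow> 'b" where
  "D i g \<equiv> along (\<xi> i) g"

text \<open>The connection coefficients of the flat connection of u-space in the frame
  \<open>\<xi>\<close>.\<close>

definition \<Gamma> :: "3 \<Rightarrow> 3 \<Rightarrow> 3 \<Rightarrow> real^3 \<Rightarrow> real" where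
  "\<Gamma> k i j u = \<omega> k u \<bullet> D i (\<xi> j) u"

text \<open>In \<open>Q\<close> and \<open>S\<close> the frame vectors are frozen at
  \<open>u\<close>, so these are values of the tensors D^2 f and D^3 f; derivatives of the frame
  enter only through \<open>\<Gamma>\<close>.\<close>

definition Q :: "3 \<Rightarrow> 3 \<Rightarrow> real^3 \<Rightarrow> real^3" where
  "Q i j u = dir_deriv (dir_deriv f (\<xi> i u)) (\<xi> j u) u"

definition q :: "3 \<Rightarrow> 3 \<Rightarrow> 3 \<Rightarrow> real^3 \<Rightarrow> real" where
  "q k i j u = \<omega> k u \<bullet> Q i j u"

definition S :: "3 \<Rightarrow> 3 \<Rightarrow> 3 \<Rightarrow> real^3 \<Rightarrow> real^3" where
  "S i j k u = dir_deriv (dir_deriv (dir_deriv f (\<xi> i u)) (\<xi> j u)) (\<xi> k u) u"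

lemma smooth_D: "smooth_on V g \<Longrightarrow> smooth_on V (D i g)" for g :: "_ \<Rightarrow> 'b::euclidean_space"
  by (rule smooth_on_along[OF V smooth_xi])

lemma smooth_Gamma: "smooth_on V (\<Gamma> k i j)"
  unfolding \<Gamma>_def[abs_def] by (rule smooth_on_inner[OF V smooth_omega smooth_D[OF smooth_xi]])

lemma smooth_Q: "smooth_on V (Q i j)"
proof (cases "V = {}")
  case True
  then show ?thesis using smooth_on_cong[OF V _ smooth_on_const[of V 0], of "Q i j"] by blast
next
  case False
  then show ?thesis
    unfolding Q_def[abs_def] using dir_deriv_field2(2)[OF V smooth_f _ smooth_xi smooth_xi] by blast
qed

lemma smooth_q: "smooth_on V (q k i j)"
  unfolding q_def[abs_def] by (rule smooth_on_inner[OF V smooth_omega smooth_Q])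

lemma D_xi: "u \<in> V \<Longrightarrow> D i (\<xi> j) u = (\<Sum>k\<in>UNIV. \<Gamma> k i j u *\<^sub>R \<xi> k u)"
  unfolding \<Gamma>_def by (rule expand)

lemma omega_sum: "u \<in> V \<Longrightarrow> \<omega> m u \<bullet> (\<Sum>k\<in>UNIV. a k *\<^sub>R \<xi> k u) = a m"
  by (simp add: inner_sum_right dual if_distrib[of "\<lambda>x. _ * x"] cong: if_cong)

lemma frame_eqI: "u \<in> V \<Longrightarrow> (\<And>m. \<omega> m u \<bullet> x = \<omega> m u \<bullet> y) \<Longrightarrow> x = y"
  using expand[of u x] expand[of u y] by simp

lemma Gamma_diag: "u \<in> V \<Longrightarrow> \<Gamma> k i i u = 0"
  by (simp add: \<Gamma>_def straight)

lemma D_Gamma_diag: "u \<in> V \<Longrightarrow> D j (\<Gamma> k i i) u = 0"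
  using along_cong[OF V, of u "\<Gamma> k i i" "\<lambda>_. 0" "\<xi> j"] by (simp add: Gamma_diag along_const)

text \<open>The flat connection has no torsion, so the Lie bracket of two frame fields is the
  antisymmetric part of \<open>\<Gamma>\<close>.\<close>

lemma commutator:
  fixes g :: "_ \<Rightarrow> 'b::euclidean_space"
  assumes u: "u \<in> V" and g: "smooth_on V g"
  shows "D i (D j g) u - D j (D i g) u = (\<Sum>n\<in>UNIV. (\<Gamma> n i j u - \<Gamma> n j i u) *\<^sub>R D n g u)"
proof -
  have "D i (\<xi> j) u - D j (\<xi> i) u = (\<Sum>n\<in>UNIV. (\<Gamma> n i j u - \<Gamma> n j i u) *\<^sub>R \<xi> n u)"
    by (simp add: D_xi[OF u] sum_subtractf scaleR_diff_left)
  then show ?thesis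
    using along_commutator[OF V u smooth_xi smooth_xi g, of i j] linear_dir_deriv1[OF V g u]
    by (simp add: linear_sum[OF linear_dir_deriv1[OF V g u]] linear_cmul[OF linear_dir_deriv1[OF V g u]] along_def)
qed

lemma D_frame_sum:
  assumes u: "u \<in> V" and a: "\<And>k. smooth_on V (a k)"
  shows "\<omega> m u \<bullet> D i (\<lambda>v. \<Sum>k\<in>UNIV. a k v *\<^sub>R \<xi> k v) u = D i (a m) u + (\<Sum>k\<in>UNIV. a k u * \<Gamma> m i k u)"
  by (simp add: along_sum[OF u smooth_on_scaleR[OF V a smooth_xi]] along_scaleR[OF u a smooth_xi]
      sum.distrib inner_add_right inner_sum_right dual[OF u] if_distrib[of "\<lambda>x. _ * x"] \<Gamma>_def cong: if_cong)

text \<open>Flatness of the affine structure of \<open>u\<close>-space, written in the moving frame.\<close>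

lemma flat:
  assumes u: "u \<in> V"
  shows "D i (\<Gamma> m j k) u - D j (\<Gamma> m i k) u =
    (\<Sum>n\<in>UNIV. (\<Gamma> n i j u - \<Gamma> n j i u) * \<Gamma> m n k u)
    - (\<Sum>n\<in>UNIV. \<Gamma> n j k u * \<Gamma> m i n u) + (\<Sum>n\<in>UNIV. \<Gamma> n i k u * \<Gamma> m j n u)"
proof -
  have "\<omega> m u \<bullet> D i (D j (\<xi> k)) u = D i (\<Gamma> m j k) u + (\<Sum>n\<in>UNIV. \<Gamma> n j k u * \<Gamma> m i n u)" for i j
    using along_cong[OF V u, of "D j (\<xi> k)" "\<lambda>v. \<Sum>n\<in>UNIV. \<Gamma> n j k v *\<^sub>R \<xi> n v" "\<xi> i", OF D_xi] D_frame_sum[OF u, of "\<lambda>n. \<Gamma> n j k" m i] by (simp add: smooth_Gamma)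
  \<comment> \<open>The same commutator, now evaluated as a derivative along the bracket; equating
    both expressions says that the curvature is zero.\<close>
  moreover have "\<omega> m u \<bullet> (D i (D j (\<xi> k)) u - D j (D i (\<xi> k)) u) = (\<Sum>n\<in>UNIV. (\<Gamma> n i j u - \<Gamma> n j i u) * \<Gamma> m n k u)"
    unfolding commutator[OF u smooth_xi] by (simp add: inner_sum_right \<Gamma>_def)
  ultimately show ?thesis by (simp add: inner_diff_right)
qed

section \<open>Second and third derivatives of the flux in the frame\<close>

lemma Q_commute: "u \<in> V \<Longrightarrow> Q i j u = Q j i u"
  unfolding Q_def by (rule dir_deriv_commute[OF V _ smooth_f])

lemma q_commute: "u \<in> V \<Longrightarrow> q k i j u = q k j i u"
  by (simp add: q_def Q_commute)

text \<open>Differentiate the eigenvector equation for \<open>\<xi> j\<close> along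
  \<open>\<xi> i\<close> and take the \<open>\<xi> k\<close>-component.\<close>

lemma q_eq:
  assumes u: "u \<in> V"
  shows "q k i j u = (if k = j then D i (lam j) u else 0) + (lam j u - lam k u) * \<Gamma> k i j u"
proof -
  have lin: "linear (\<lambda>x. dir_deriv f x u)" by (rule linear_dir_deriv1[OF V smooth_f u])
  have "D i (\<lambda>v. lam j v *\<^sub>R \<xi> j v) u = D i (\<lambda>v. dir_deriv f (\<xi> j v) v) u"
    by (rule along_cong[OF V u]) (simp add: eigen)
  also have "\<dots> = Q j i u + dir_deriv f (D i (\<xi> j) u) u"
    unfolding along_def Q_def by (rule dir_deriv_field[OF V smooth_f u smooth_xi])
  also have "dir_deriv f (D i (\<xi> j) u) u = (\<Sum>k\<in>UNIV. (\<Gamma> k i j u * lam k u) *\<^sub>R \<xi> k u)"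
    by (simp add: D_xi[OF u] linear_sum[OF lin] linear_cmul[OF lin] eigen[OF u])
  finally have "\<omega> k u \<bullet> D i (\<lambda>v. lam j v *\<^sub>R \<xi> j v) u = q k j i u + \<Gamma> k i j u * lam k u"
    by (simp add: inner_add_right omega_sum[OF u] q_def)
  moreover have "\<omega> k u \<bullet> D i (\<lambda>v. lam j v *\<^sub>R \<xi> j v) u = lam j u * \<Gamma> k i j u + (if k = j then D i (lam j) u else 0)"
    by (simp add: along_scaleR[OF u smooth_lam smooth_xi] inner_add_right dual[OF u] \<Gamma>_def)
  ultimately show ?thesis by (simp add: q_commute[OF u, of k i j] algebra_simps split: if_splits)
qed

text \<open>Both halves of the T-property enter: straightness kills \<open>\<Gamma> k i i\<close>,
  and constancy of \<open>lam i\<close> along \<open>\<xi> i\<close> kills the other term.\<close>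

lemma q_diag: "u \<in> V \<Longrightarrow> q k i i u = 0"
  by (simp add: q_eq lam_const Gamma_diag)

lemma Q_diag: "u \<in> V \<Longrightarrow> Q i i u = 0"
  by (rule frame_eqI) (use q_diag in \<open>simp_all add: q_def\<close>)

lemma Q_expand: "u \<in> V \<Longrightarrow> Q i j u = (\<Sum>k\<in>UNIV. q k i j u *\<^sub>R \<xi> k u)"
  unfolding q_def by (rule expand)

lemma D_Q:
  assumes u: "u \<in> V"
  shows "D k (Q i j) u = S i j k u + (\<Sum>n\<in>UNIV. \<Gamma> n k i u *\<^sub>R Q n j u) + (\<Sum>n\<in>UNIV. \<Gamma> n k j u *\<^sub>R Q i n u)"
proof -
  have l1: "linear (\<lambda>x. dir_deriv (dir_deriv f x) y u)" for y by (rule linear_dir_deriv2[OF V smooth_f u])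
  have l2: "linear (\<lambda>y. dir_deriv (dir_deriv f x) y u)" for x by (rule linear_dir_deriv2'[OF V smooth_f u])
  have "D k (Q i j) u = S i j k u + dir_deriv (dir_deriv f (D k (\<xi> i) u)) (\<xi> j u) u
      + dir_deriv (dir_deriv f (\<xi> i u)) (D k (\<xi> j) u) u"
    unfolding Q_def[abs_def] S_def along_def by (rule dir_deriv_field2(1)[OF V smooth_f u smooth_xi smooth_xi])
  then show ?thesis
    by (simp add: D_xi[OF u] linear_sum[OF l1] linear_cmul[OF l1] linear_sum[OF l2] linear_cmul[OF l2] Q_def)
qed

lemma omega_S:
  assumes u: "u \<in> V"
  shows "\<omega> m u \<bullet> S i j k u = D k (q m i j) u + (\<Sum>n\<in>UNIV. q n i j u * \<Gamma> m k n u)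
    - (\<Sum>n\<in>UNIV. \<Gamma> n k i u * q m n j u) - (\<Sum>n\<in>UNIV. \<Gamma> n k j u * q m i n u)"
proof -
  have "\<omega> m u \<bullet> D k (Q i j) u = D k (q m i j) u + (\<Sum>n\<in>UNIV. q n i j u * \<Gamma> m k n u)"
    using along_cong[OF V u, of "Q i j" "\<lambda>v. \<Sum>n\<in>UNIV. q n i j v *\<^sub>R \<xi> n v" "\<xi> k", OF Q_expand] D_frame_sum[OF u, of "\<lambda>n. q n i j" m k] by (simp add: smooth_q)
  then show ?thesis
    by (simp add: D_Q[OF u] inner_add_right inner_sum_right q_def)
qed

end

section \<open>The third derivative of the flux\<close>

text \<open>The algebra behind \<open>G_obstruction\<close>. Here \<open>a\<close> and
  \<open>b\<close> are the eigenvalue differences \<open>lam j - lam k\<close> and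
  \<open>lam i - lam k\<close>, \<open>c\<close> and \<open>z\<close> are \<open>q k i j\<close> and
  its derivative along \<open>\<xi> k\<close>, and \<open>r\<close>, \<open>t\<close>,
  \<open>s\<close>, \<open>w\<close> are \<open>\<Gamma> i i k\<close>,
  \<open>\<Gamma> j j k\<close>, \<open>\<Gamma> i k i\<close>, \<open>\<Gamma> j k j\<close>. Once
  \<open>ZG\<close> is eliminated, \<open>eq\<close> is the conclusion up to the factor
  \<open>- 4 * (b - a) / (a * b)\<close>.\<close>

lemma obstruction_identity:
  fixes a b c z r t s w G ZG :: real
  assumes "a \<noteq> 0" "b \<noteq> 0" "a \<noteq> b" and G: "G = c * a * b / (b - a)\<^sup>2"
    and ZG: "(b - a)\<^sup>2 * ZG + 2 * (b - a) * (t * a - r * b) * G = z * a * b - c * t * a * b - c * a * r * b"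
    and eq: "G * (4 * (c / a - c / b) * (s + w) - r * (2 * (c / b) + 3 * (c / a)) + t * (2 * (c / a) + 3 * (c / b))
      - 3 * ((z + t * c) / a - (z + r * c) / b)) = (c / a - c / b) * ZG"
  shows "G * (z - c * (s + w + (r * b - t * a) / (a - b))) = 0"
proof -
  have ZG': "ZG = (z * a * b - c * t * a * b - c * a * r * b - 2 * (b - a) * (t * a - r * b) * G) / (b - a)\<^sup>2"
    using ZG \<open>a \<noteq> b\<close> by (simp add: eq_divide_eq algebra_simps)
  have "G * (z - c * (s + w + (r * b - t * a) / (a - b))) * (- 4 * (b - a)) =
     a * b * (G * (4 * (c / a - c / b) * (s + w) - r * (2 * (c / b) + 3 * (c / a)) + t * (2 * (c / a) + 3 * (c / b))
      - 3 * ((z + t * c) / a - (z + r * c) / b)) - (c / a - c / b) * ZG)"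
    unfolding ZG' G using assms(1-3)
    by (simp add: divide_simps) algebra
  then show ?thesis using eq \<open>a \<noteq> b\<close> by simp
qed

context T_frame
begin

text \<open>The derivative of the logarithm of the distance between \<open>lam i\<close> and
  \<open>lam j\<close>, taken along \<open>\<xi> k\<close>.\<close>

definition coef :: "3 \<Rightarrow> 3 \<Rightarrow> 3 \<Rightarrow> real^3 \<Rightarrow> real" where
  "coef i j k u = (D k (lam j) u - D k (lam i) u) / (lam j u - lam i u)"

text \<open>The factors are chosen so that \<open>D i\<close> and \<open>D j\<close> multiply \<open>G i j k\<close> by connection
  coefficients only (lemma \<open>D_G\<close>); \<open>[D i, D j]\<close> applied to \<open>G i j k\<close> is then computable from flatness.\<close>

definition G :: "3 \<Rightarrow> 3 \<Rightarrow> 3 \<Rightarrow> real^3 \<Rightarrow> real" where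
  "G i j k u = q k i j u * (lam j u - lam k u) * (lam i u - lam k u)
     / ((lam i u - lam j u) * (lam i u - lam j u))"

lemmas smooth_intros =
  smooth_on_mult[OF V] smooth_on_diff[OF V] smooth_on_add[OF V] smooth_on_const smooth_lam smooth_Gamma smooth_q
  smooth_D

lemma coef_commute: "coef i j k u = coef j i k u"
  unfolding coef_def by (metis minus_diff_eq minus_divide_divide)

lemma smooth_coef: "i \<noteq> j \<Longrightarrow> smooth_on V (coef i j k)"
  unfolding coef_def[abs_def] using distinct[of _ j i]
  by (intro smooth_on_divide[OF V] smooth_on_diff[OF V] smooth_D smooth_lam) auto

lemma smooth_G: "i \<noteq> j \<Longrightarrow> smooth_on V (G i j k)"
  unfolding G_def[abs_def] using distinct[of _ i j]
  by (intro smooth_on_divide[OF V] smooth_on_diff[OF V] smooth_on_mult[OF V] smooth_lam smooth_q) auto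

lemma G_commute: "u \<in> V \<Longrightarrow> G i j k u = G j i k u"
  unfolding G_def q_commute[of u k i j] by (simp add: algebra_simps)

lemma q_off: "u \<in> V \<Longrightarrow> k \<noteq> j \<Longrightarrow> q k i j u = (lam j u - lam k u) * \<Gamma> k i j u"
  by (simp add: q_eq)

lemma q_lam: "u \<in> V \<Longrightarrow> q j i j u = D i (lam j) u"
  by (simp add: q_eq)

text \<open>Compares the two values that \<open>q_eq\<close> gives to \<open>q j i j\<close> and
  \<open>q j j i\<close>, which agree by symmetry.\<close>

lemma Gamma_lam: "u \<in> V \<Longrightarrow> i \<noteq> j \<Longrightarrow> D i (lam j) u = (lam i u - lam j u) * \<Gamma> j j i u"
  by (metis q_lam q_off q_commute)

text \<open>The components of D^2 f other than \<open>q k i j\<close> that occur here are eigenvalue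
  derivatives, and they cancel against the terms with \<open>coef i k j\<close> and
  \<open>coef j k i\<close>. What is left is the first-order expression in \<open>q k i j\<close>
  whose vanishing is the key point.\<close>

lemma omega_S_distinct:
  assumes u: "u \<in> V" and ne: "i \<noteq> j" "i \<noteq> k" "j \<noteq> k"
  shows "\<omega> k u \<bullet> S i j k u
      - (coef i j k u * q k i j u + coef i k j u * q k i k u + coef j k i u * q k j k u)
    = D k (q k i j) u - q k i j u * (\<Gamma> i k i u + \<Gamma> j k j u + coef i j k u)"
proof -
  have l: "lam i u \<noteq> lam j u" "lam i u \<noteq> lam k u" "lam j u \<noteq> lam k u" using distinct[OF u] ne by auto
  have "q k k j u = q k j k u" "q i i j u = q i j i u" using q_commute[OF u] by auto
  moreover have "coef i k j u * q k i k u = (D j (lam i) u - D j (lam k) u) * \<Gamma> k k i u"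
    "coef j k i u * q k j k u = (D i (lam j) u - D i (lam k) u) * \<Gamma> k k j u"
    using l ne by (simp_all add: coef_def q_lam[OF u] Gamma_lam[OF u, of i k] Gamma_lam[OF u, of j k] field_simps)
  ultimately show ?thesis
    by (simp add: omega_S[OF u] sum_3_distinct[OF ne] q_diag[OF u] Gamma_diag[OF u] q_lam[OF u] algebra_simps)
qed

text \<open>Flatness supplies the derivative of \<open>\<Gamma> k j i\<close> and
  \<open>Gamma_lam\<close> those of the eigenvalues. Every resulting term contains
  \<open>\<Gamma> k j i\<close> or its multiple \<open>\<Gamma> k i j\<close>, hence is a multiple
  of \<open>G i j k\<close>.\<close>

lemma D_G:
  assumes u: "u \<in> V" and ne: "i \<noteq> j" "i \<noteq> k" "j \<noteq> k"
  shows "D i (G i j k) u = G i j k u * (\<Gamma> j i j u - \<Gamma> k i k u - 3 * \<Gamma> k k i u)"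
proof -
  have l: "lam i u \<noteq> lam j u" "lam i u \<noteq> lam k u" "lam j u \<noteq> lam k u" using distinct[OF u] ne by auto
  have G: "(lam i v - lam j v) * (lam i v - lam j v) * G i j k v
      = \<Gamma> k j i v * (lam i v - lam k v) * (lam i v - lam k v) * (lam j v - lam k v)" if "v \<in> V" for v
    using distinct[OF that ne(1)] q_commute[OF that, of k i j] q_off[OF that, of k i j] ne
    by (simp add: G_def)
  have "D i (\<lambda>v. (lam i v - lam j v) * (lam i v - lam j v) * G i j k v) u
      = D i (\<lambda>v. \<Gamma> k j i v * (lam i v - lam k v) * (lam i v - lam k v) * (lam j v - lam k v)) u"
    by (rule along_cong[OF V u G])
  then have DG: "(lam i u - lam j u)\<^sup>2 * D i (G i j k) u - 2 * (lam i u - lam j u) * D i (lam j) u * G i j k u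
      = D i (\<Gamma> k j i) u * (lam i u - lam k u)\<^sup>2 * (lam j u - lam k u)
        - 2 * \<Gamma> k j i u * (lam i u - lam k u) * D i (lam k) u * (lam j u - lam k u)
        + \<Gamma> k j i u * (lam i u - lam k u)\<^sup>2 * (D i (lam j) u - D i (lam k) u)"
    by (simp only: along_mult[OF u] along_diff[OF u] smooth_intros smooth_G[OF ne(1)] lam_const[OF u]) algebra
  \<comment> \<open>In this instance of flatness the second derivative term belongs to
    \<open>\<Gamma> k i i\<close>, which vanishes identically.\<close>
  have DGam: "D i (\<Gamma> k j i) u = (\<Gamma> j i j u - \<Gamma> j j i u) * \<Gamma> k j i u + (\<Gamma> k i j u - \<Gamma> k j i u) * \<Gamma> k k i u
      - \<Gamma> j j i u * \<Gamma> k i j u - \<Gamma> k j i u * \<Gamma> k i k u"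
    using flat[OF u, of i k j i]
    by (simp add: sum_3_distinct[OF ne] Gamma_diag[OF u] D_Gamma_diag[OF u])
  have p: "\<Gamma> k i j u = \<Gamma> k j i u * (lam i u - lam k u) / (lam j u - lam k u)"
    using q_commute[OF u, of k i j] q_off[OF u, of k i j] q_off[OF u, of k j i] ne l by (simp add: field_simps)
  have G': "G i j k u = \<Gamma> k j i u * (lam i u - lam k u)\<^sup>2 * (lam j u - lam k u) / (lam i u - lam j u)\<^sup>2"
    using ne q_off[OF u, of k i j] by (simp add: G_def q_commute[OF u, of k i j] power2_eq_square)
  show ?thesis
    using DG l unfolding DGam Gamma_lam[OF u ne(1)] Gamma_lam[OF u ne(2)] G' p
    by (simp add: divide_simps) algebra
qed

text \<open>The commutator of \<open>D i\<close> and \<open>D j\<close> on \<open>G i j k\<close> is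
  found twice: from the multipliers \<open>?\<alpha>\<close> and \<open>?\<beta>\<close>, and as the
  derivative along the bracket, which brings in \<open>D k (G i j k)\<close>. The comparison is the
  asserted product up to a nonzero factor.\<close>

lemma G_obstruction:
  assumes u: "u \<in> V" and ne: "i \<noteq> j" "i \<noteq> k" "j \<noteq> k"
  shows "G i j k u * (D k (q k i j) u - q k i j u * (\<Gamma> i k i u + \<Gamma> j k j u + coef i j k u)) = 0"
proof -
  have ne': "j \<noteq> i" "k \<noteq> i" "k \<noteq> j" using ne by auto
  have li: "lam i u \<noteq> lam j u" "lam i u \<noteq> lam k u" "lam j u \<noteq> lam k u" using distinct[OF u] ne by auto
  let ?\<alpha> = "\<lambda>v. \<Gamma> j i j v - \<Gamma> k i k v - 3 * \<Gamma> k k i v"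
  let ?\<beta> = "\<lambda>v. \<Gamma> i j i v - \<Gamma> k j k v - 3 * \<Gamma> k k j v"
  have sG: "smooth_on V (G i j k)" by (rule smooth_G[OF ne(1)])
  have s\<alpha>: "smooth_on V ?\<alpha>" and s\<beta>: "smooth_on V ?\<beta>"
    by (simp_all add: smooth_intros)
  have Di: "D i (G i j k) v = G i j k v * ?\<alpha> v" if "v \<in> V" for v
    by (rule D_G[OF that ne])
  \<comment> \<open>\<open>G i j k\<close> is symmetric in \<open>i\<close> and \<open>j\<close>, so
    its multiplier along \<open>\<xi> j\<close> is \<open>?\<alpha>\<close> with these indices
    exchanged.\<close>
  have Dj: "D j (G i j k) v = G i j k v * ?\<beta> v" if "v \<in> V" for v
    using D_G[OF that ne'(1) ne(3,2)] along_cong[OF V that, of "G i j k" "G j i k" "\<xi> j", OF G_commute]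
    by (simp add: G_commute[OF that, of i j])
  have "D i (D j (G i j k)) u = D i (\<lambda>v. G i j k v * ?\<beta> v) u"
    by (rule along_cong[OF V u Dj])
  also have "\<dots> = G i j k u * D i ?\<beta> u + D i (G i j k) u * ?\<beta> u"
    by (rule along_mult[OF u sG s\<beta>])
  finally have Dij: "D i (D j (G i j k)) u = G i j k u * D i ?\<beta> u + D i (G i j k) u * ?\<beta> u" .
  have "D j (D i (G i j k)) u = D j (\<lambda>v. G i j k v * ?\<alpha> v) u"
    by (rule along_cong[OF V u Di])
  also have "\<dots> = G i j k u * D j ?\<alpha> u + D j (G i j k) u * ?\<alpha> u"
    by (rule along_mult[OF u sG s\<alpha>])
  finally have Dji: "D j (D i (G i j k)) u = G i j k u * D j ?\<alpha> u + D j (G i j k) u * ?\<alpha> u" .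
  have D\<beta>: "D i ?\<beta> u = D i (\<Gamma> i j i) u - D i (\<Gamma> k j k) u - 3 * D i (\<Gamma> k k j) u"
    and D\<alpha>: "D j ?\<alpha> u = D j (\<Gamma> j i j) u - D j (\<Gamma> k i k) u - 3 * D j (\<Gamma> k k i) u"
    by (simp_all add: along_diff[OF u] along_mult[OF u] along_const smooth_intros)
  \<comment> \<open>The products of \<open>?\<alpha>\<close> and \<open>?\<beta>\<close> cancel, so
    only derivatives of the multipliers stay on the left.\<close>
  have comm: "G i j k u * (D i ?\<beta> u - D j ?\<alpha> u) =
      (\<Gamma> i i j u - \<Gamma> i j i u) * (G i j k u * ?\<alpha> u) + (\<Gamma> j i j u - \<Gamma> j j i u) * (G i j k u * ?\<beta> u)
      + (\<Gamma> k i j u - \<Gamma> k j i u) * D k (G i j k) u"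
    using commutator[OF u sG, of i j] unfolding Dij Dji Di[OF u] Dj[OF u] sum_3_distinct[OF ne] real_scaleR_def
    by algebra
  note simps = sum_3_distinct[OF ne] Gamma_diag[OF u] D_Gamma_diag[OF u]
  \<comment> \<open>These five equations reduce all derivatives in
    \<open>D i ?\<beta> u - D j ?\<alpha> u\<close> to products of connection coefficients, except
    the derivatives of \<open>\<Gamma> k i j\<close> and \<open>\<Gamma> k j i\<close> along
    \<open>\<xi> k\<close>.\<close>
  note F1 = flat[OF u, of i i j i, unfolded simps]
  note F2 = flat[OF u, of i j j j, unfolded simps]
  note F3 = flat[OF u, of i k j k, unfolded simps]
  note F4 = flat[OF u, of j k k i, unfolded simps]
  note F5 = flat[OF u, of i k k j, unfolded simps]
  have R: "D i ?\<beta> u - D j ?\<alpha> u - (\<Gamma> i i j u - \<Gamma> i j i u) * ?\<alpha> u - (\<Gamma> j i j u - \<Gamma> j j i u) * ?\<beta> u =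
      4 * (\<Gamma> k i j u - \<Gamma> k j i u) * (\<Gamma> i k i u + \<Gamma> j k j u)
      - \<Gamma> i i k u * (2 * \<Gamma> k j i u + 3 * \<Gamma> k i j u) + \<Gamma> j j k u * (2 * \<Gamma> k i j u + 3 * \<Gamma> k j i u)
      - 3 * (D k (\<Gamma> k i j) u - D k (\<Gamma> k j i) u)"
    using F1 F2 F3 F4 F5 unfolding D\<alpha> D\<beta> by algebra
  let ?a = "lam j u - lam k u" and ?b = "lam i u - lam k u" and ?c = "q k i j u" and ?z = "D k (q k i j) u"
  \<comment> \<open>By symmetry of D^2 f both coefficients are the single function
    \<open>q k i j\<close> divided by an eigenvalue difference; \<open>zp\<close> and
    \<open>zq\<close> express their remaining derivatives through it as well.\<close>
  have p3: "\<Gamma> k i j u = ?c / ?a" and q3: "\<Gamma> k j i u = ?c / ?b"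
    using q_commute[OF u, of k i j] q_off[OF u, of k i j] q_off[OF u, of k j i] ne li
    by (simp_all add: field_simps)
  have E: "D k (lam i) u = - (\<Gamma> i i k u * ?b)" and F: "D k (lam j) u = - (\<Gamma> j j k u * ?a)"
    by (simp_all add: Gamma_lam[OF u ne'(2)] Gamma_lam[OF u ne'(3)] algebra_simps)
  have "?z = D k (\<lambda>v. (lam j v - lam k v) * \<Gamma> k i j v) u"
    by (rule along_cong[OF V u]) (use q_off[of _ k j i] ne in simp)
  then have zp: "D k (\<Gamma> k i j) u = (?z + \<Gamma> j j k u * ?c) / ?a"
    using li by (simp add: along_mult[OF u] along_diff[OF u] smooth_intros lam_const[OF u] F p3 eq_divide_eq)
  have "?z = D k (\<lambda>v. (lam i v - lam k v) * \<Gamma> k j i v) u"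
    by (rule along_cong[OF V u]) (use q_off[of _ k i j] q_commute[of _ k i j] ne in simp)
  then have zq: "D k (\<Gamma> k j i) u = (?z + \<Gamma> i i k u * ?c) / ?b"
    using li by (simp add: along_mult[OF u] along_diff[OF u] smooth_intros lam_const[OF u] E q3 eq_divide_eq)
  have G: "(lam i v - lam j v) * (lam i v - lam j v) * G i j k v
      = q k i j v * (lam j v - lam k v) * (lam i v - lam k v)" if "v \<in> V" for v
    using distinct[OF that ne(1)] by (simp add: G_def)
  have "D k (\<lambda>v. (lam i v - lam j v) * (lam i v - lam j v) * G i j k v) u
      = D k (\<lambda>v. q k i j v * (lam j v - lam k v) * (lam i v - lam k v)) u"
    by (rule along_cong[OF V u G])
  then have ZG: "(?b - ?a)\<^sup>2 * D k (G i j k) u + 2 * (?b - ?a) * (\<Gamma> j j k u * ?a - \<Gamma> i i k u * ?b) * G i j k u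
      = ?z * ?a * ?b - ?c * \<Gamma> j j k u * ?a * ?b - ?c * ?a * \<Gamma> i i k u * ?b"
    by (simp only: along_mult[OF u] along_diff[OF u] smooth_intros sG lam_const[OF u] E F) algebra
  have coef: "coef i j k u = (\<Gamma> i i k u * ?b - \<Gamma> j j k u * ?a) / (?a - ?b)"
    unfolding coef_def E F by simp
  show ?thesis
    unfolding coef
  proof (rule obstruction_identity[OF _ _ _ _ ZG])
    show "G i j k u * (4 * (?c / ?a - ?c / ?b) * (\<Gamma> i k i u + \<Gamma> j k j u)
        - \<Gamma> i i k u * (2 * (?c / ?b) + 3 * (?c / ?a)) + \<Gamma> j j k u * (2 * (?c / ?a) + 3 * (?c / ?b))
        - 3 * ((?z + \<Gamma> j j k u * ?c) / ?a - (?z + \<Gamma> i i k u * ?c) / ?b)) = (?c / ?a - ?c / ?b) * D k (G i j k) u"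
      using comm R unfolding zp zq unfolding p3 q3 by algebra
  qed (use li in \<open>simp_all add: G_def power2_eq_square\<close>)
qed

end

context T_frame
begin

text \<open>Off the zero set of \<open>q k i j\<close> the obstruction vanishes by \<open>G_obstruction\<close>, in its interior because
  \<open>q k i j\<close> and its derivative vanish there, and then everywhere by continuity.\<close>

lemma obstruction_zero:
  assumes u: "u \<in> V" and ne: "i \<noteq> j" "i \<noteq> k" "j \<noteq> k"
  shows "D k (q k i j) u - q k i j u * (\<Gamma> i k i u + \<Gamma> j k j u + coef i j k u) = 0" (is "?T u = 0")
proof (rule ccontr)
  assume "?T u \<noteq> 0"
  have "smooth_on V ?T"
    using smooth_coef[OF ne(1)] by (simp add: smooth_intros)
  then have "open (V \<inter> ?T -` (- {0}))"
    by (intro continuous_open_preimage[OF smooth_on_continuous_on V]) auto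
  moreover have "q k i j v = 0" if "v \<in> V \<inter> ?T -` (- {0})" for v
    using G_obstruction[of v, OF _ ne] that distinct[of v] ne by (auto simp: G_def)
  moreover have "u \<in> V \<inter> ?T -` (- {0})" using u \<open>?T u \<noteq> 0\<close> by simp
  ultimately obtain N where N: "open N" "u \<in> N" "\<And>v. v \<in> N \<Longrightarrow> q k i j v = 0" by blast
  then have "D k (q k i j) u = 0"
    using along_cong[OF N(1,2), of "q k i j" "\<lambda>_. 0" "\<xi> k"] N(3) by (simp add: along_const)
  with N(3)[OF N(2)] have "?T u = 0" by simp
  with \<open>?T u \<noteq> 0\<close> show False by simp
qed

lemma S_commute: "u \<in> V \<Longrightarrow> S i j k u = S j i k u" "u \<in> V \<Longrightarrow> S i j k u = S i k j u"
proof -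
  assume u: "u \<in> V"
  show "S i j k u = S i k j u"
    unfolding S_def by (rule dir_deriv_commute[OF V u smooth_on_dir_deriv[OF smooth_f]])
  show "S i j k u = S j i k u"
    unfolding S_def by (rule dir_deriv_cong[OF V u]) (rule dir_deriv_commute[OF V _ smooth_f])
qed

text \<open>Both sides are symmetric under permutations of the indices, so each frame component is
  an instance of \<open>obstruction_zero\<close> with that component as the last index.\<close>

lemma third_derivative:
  assumes u: "u \<in> V" and ne: "i \<noteq> j" "i \<noteq> k" "j \<noteq> k"
  shows "S i j k u = coef i j k u *\<^sub>R Q i j u + coef i k j u *\<^sub>R Q i k u + coef j k i u *\<^sub>R Q j k u"
proof (rule frame_eqI[OF u])
  have c: "\<omega> n u \<bullet> S l m n u
      = \<omega> n u \<bullet> (coef l m n u *\<^sub>R Q l m u + coef l n m u *\<^sub>R Q l n u + coef m n l u *\<^sub>R Q m n u)"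
    if "l \<noteq> m" "l \<noteq> n" "m \<noteq> n" for l m n
    using omega_S_distinct[OF u that] obstruction_zero[OF u that] by (simp add: inner_add_right q_def)
  have perm: "S i k j u = S i j k u" "S j k i u = S i j k u" "Q k j u = Q j k u" "Q j i u = Q i j u" "Q k i u = Q i k u"
    "coef k j i u = coef j k i u" "coef j i k u = coef i j k u" "coef k i j u = coef i k j u"
    using S_commute[OF u] Q_commute[OF u] coef_commute by metis+
  fix m
  have "m = i \<or> m = j \<or> m = k"
    using sum_3_distinct[OF ne, of "\<lambda>n. if n = m then 1 else 0 :: nat"] by (auto split: if_splits)
  then show "\<omega> m u \<bullet> S i j k u
      = \<omega> m u \<bullet> (coef i j k u *\<^sub>R Q i j u + coef i k j u *\<^sub>R Q i k u + coef j k i u *\<^sub>R Q j k u)"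
    using c[of i j k] c[of i k j] c[of j k i] ne ne[symmetric] by (elim disjE) (simp_all add: perm inner_add_right)
qed

end

section \<open>Straight rarefaction curves\<close>

lemma smooth_on_compact_bound:
  assumes "smooth_on U g" "compact K" "K \<subseteq> U"
  shows "\<exists>M\<ge>0. \<forall>v\<in>K. norm (g v) \<le> M"
proof -
  have "bounded (g ` K)"
    by (rule compact_imp_bounded[OF compact_continuous_image[OF
        continuous_on_subset[OF smooth_on_continuous_on[OF assms(1)] assms(3)] assms(2)]])
  then show ?thesis unfolding bounded_pos by (auto intro: less_imp_le)
qed

text \<open>The sum of the bounds in the basis directions bounds the operator norm of the derivative
  on \<open>K\<close>; the mean value inequality on the convex set \<open>K\<close> does the
  rest.\<close>

lemma smooth_on_lipschitz:
  fixes X :: "'a::euclidean_space \<Rightarrow> 'b::euclidean_space"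
  assumes "smooth_on U X" "compact K" "convex K" "K \<subseteq> U"
  obtains L where "L > 0" "\<And>v w. v \<in> K \<Longrightarrow> w \<in> K \<Longrightarrow> norm (X v - X w) \<le> L * norm (v - w)"
proof -
  have "\<exists>B>0. \<forall>v\<in>K. norm (dir_deriv X b v) \<le> B" for b
  proof -
    obtain M where "M \<ge> 0" "\<forall>v\<in>K. norm (dir_deriv X b v) \<le> M"
      using smooth_on_compact_bound[OF smooth_on_dir_deriv[OF assms(1)] assms(2,4)] by blast
    then show ?thesis by (intro exI[of _ "M + 1"]) (auto intro: add_increasing2)
  qed
  then obtain B where B: "\<And>b. B b > 0" "\<And>b v. v \<in> K \<Longrightarrow> norm (dir_deriv X b v) \<le> B b" by metis
  define L where "L = (\<Sum>b\<in>Basis. B b)"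
  have L: "L > 0" unfolding L_def by (rule sum_pos) (auto simp: B)
  have "norm (dir_deriv X x v) \<le> L * norm x" if "v \<in> K" for x v
  proof -
    have lin: "linear (\<lambda>x. dir_deriv X x v)"
      using dir_deriv_linear[OF smooth_on_differentiable[OF assms(1)]] that assms(4) by blast
    have "dir_deriv X x v = dir_deriv X (\<Sum>b\<in>Basis. (x \<bullet> b) *\<^sub>R b) v" by (simp add: euclidean_representation)
    also have "\<dots> = (\<Sum>b\<in>Basis. (x \<bullet> b) *\<^sub>R dir_deriv X b v)"
      by (simp only: linear_sum[OF lin] linear_cmul[OF lin])
    also have "norm \<dots> \<le> (\<Sum>b\<in>Basis. B b * norm x)"
    proof (rule sum_norm_le)
      fix b :: 'a assume "b \<in> Basis"
      have "\<bar>x \<bullet> b\<bar> * norm (dir_deriv X b v) \<le> norm x * B b"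
        using B(2)[OF that] Basis_le_norm[OF \<open>b \<in> Basis\<close>] by (intro mult_mono) auto
      then show "norm ((x \<bullet> b) *\<^sub>R dir_deriv X b v) \<le> B b * norm x" by (simp add: mult.commute)
    qed
    finally show ?thesis by (simp add: L_def sum_distrib_right)
  qed
  then have "norm (X v - X w) \<le> L * norm (v - w)" if "v \<in> K" "w \<in> K" for v w
    using that assms smooth_on_differentiable[OF assms(1)]
    by (intro differentiable_bound[OF assms(3), where f' = "\<lambda>u x. dir_deriv X x u"])
      (auto intro!: has_derivative_at_withinI has_derivative_dir_deriv onorm_le)
  with L that show thesis by blast
qed

text \<open>Picard's theorem by a contraction on bounded continuous functions on the whole line. To
  define the operator on all of that space, the field is extended by nearest-point projection and
  time is clamped; neither change is visible on the open time interval.\<close>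

lemma local_flow_exists:
  fixes X :: "'a::euclidean_space \<Rightarrow> 'a"
  assumes "open U" "u0 \<in> U" "smooth_on U X"
  obtains \<tau> \<gamma> where "\<tau> > 0" "\<gamma> 0 = u0"
    "\<And>t. t \<in> {-\<tau><..<\<tau>} \<Longrightarrow> \<gamma> t \<in> U \<and> (\<gamma> has_vector_derivative X (\<gamma> t)) (at t)"
proof -
  obtain r where r: "r > 0" "cball u0 r \<subseteq> U" using assms(1,2) open_contains_cball by blast
  let ?K = "cball u0 r"
  obtain L where L: "L > 0" "\<And>v w. v \<in> ?K \<Longrightarrow> w \<in> ?K \<Longrightarrow> norm (X v - X w) \<le> L * norm (v - w)"
    using smooth_on_lipschitz[OF assms(3) compact_cball convex_cball r(2)] by blast
  obtain M' where M': "M' \<ge> 0" "\<forall>v\<in>?K. norm (X v) \<le> M'"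
    using smooth_on_compact_bound[OF assms(3) compact_cball r(2)] by blast
  define M where "M = M' + 1"
  have M: "M > 0" "\<And>v. v \<in> ?K \<Longrightarrow> norm (X v) \<le> M" using M' by (auto simp: M_def intro: add_increasing2)
  have K: "convex ?K" "closed ?K" "?K \<noteq> {}" using r by auto
  \<comment> \<open>The projection onto the ball does not increase distances, so \<open>Y\<close>
    inherits the bound \<open>M\<close> and the Lipschitz constant \<open>L\<close>
    globally.\<close>
  define Y where "Y v = X (closest_point ?K v)" for v
  have inK: "closest_point ?K v \<in> ?K" for v by (rule closest_point_in_set[OF K(2,3)])
  have Yle: "norm (Y v) \<le> M" for v unfolding Y_def by (rule M(2)[OF inK])
  have YL: "norm (Y v - Y w) \<le> L * norm (v - w)" for v w
  proof -
    have "norm (Y v - Y w) \<le> L * norm (closest_point ?K v - closest_point ?K w)"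
      unfolding Y_def by (rule L(2)[OF inK inK])
    also have "\<dots> \<le> L * norm (v - w)"
      using closest_point_lipschitz[OF K, of v w] L(1) by (intro mult_left_mono) (auto simp: dist_norm)
    finally show ?thesis .
  qed
  have Ycont: "continuous_on S (\<lambda>t. Y (g t))" if "continuous_on S g" for S and g :: "real \<Rightarrow> 'a"
  proof (rule continuous_on_compose2[OF _ that, of UNIV])
    show "continuous_on UNIV Y"
      by (rule lipschitz_on_continuous_on[of L], rule lipschitz_onI) (use YL L in \<open>auto simp: dist_norm\<close>)
  qed auto
  \<comment> \<open>The first bound keeps the solution in the ball, the second makes the contraction
    factor 1/2. The operator uses two values of \<open>J\<close>, each an integral over length at
    most \<open>2 * \<tau>\<close>, whence the 4.\<close>
  define \<tau> where "\<tau> = min (r / (4 * M)) (1 / (8 * L))"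
  have \<tau>: "\<tau> > 0" "4 * \<tau> * M \<le> r" "4 * \<tau> * L \<le> 1 / 2"
    using r M(1) L(1) by (auto simp: \<tau>_def min_def field_simps)
  define c where "c t = max (-\<tau>) (min \<tau> t)" for t :: real
  have c: "c t \<in> {-\<tau>..\<tau>}" for t using \<tau>(1) by (auto simp: c_def)
  \<comment> \<open>Integration starts at \<open>-\<tau>\<close> to treat negative and positive
    times alike; \<open>F\<close> then subtracts \<open>J g 0\<close> to meet the initial
    condition.\<close>
  define J where "J g t = integral {-\<tau>..t} (\<lambda>s. Y (g s))" for g :: "real \<Rightarrow> 'a" and t
  define F where "F g t = u0 + (J g (c t) - J g 0)" for g :: "real \<Rightarrow> 'a" and t
  have int: "(\<lambda>s. Y (apply_bcontfun g s)) integrable_on {-\<tau>..t}" for g t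
    by (intro integrable_continuous_real Ycont continuous_on_apply_bcontfun)
  have Jle: "norm (J (apply_bcontfun g) t) \<le> 2 * \<tau> * M" if "t \<in> {-\<tau>..\<tau>}" for g t
  proof -
    have "norm (J (apply_bcontfun g) t) \<le> M * (t - - \<tau>)"
      unfolding J_def using that M(1) Yle
      by (intro integral_bound Ycont continuous_on_apply_bcontfun Yle) auto
    also have "\<dots> \<le> M * (2 * \<tau>)" using that M(1) by (intro mult_left_mono) auto
    finally show ?thesis by (simp add: mult.commute)
  qed
  have JL: "norm (J (apply_bcontfun g) t - J (apply_bcontfun h) t) \<le> 2 * \<tau> * (L * dist g h)"
    if "t \<in> {-\<tau>..\<tau>}" for g h t
  proof -
    have "norm (J (apply_bcontfun g) t - J (apply_bcontfun h) t)
        = norm (integral {-\<tau>..t} (\<lambda>s. Y (g s) - Y (h s)))"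
      unfolding J_def by (simp add: integral_diff[OF int int])
    also have "\<dots> \<le> (L * dist g h) * (t - - \<tau>)"
    proof (rule integral_bound)
      show "continuous_on {-\<tau>..t} (\<lambda>s. Y (g s) - Y (h s))"
        by (intro continuous_on_diff Ycont continuous_on_apply_bcontfun)
      show "norm (Y (g s) - Y (h s)) \<le> L * dist g h" for s
      proof -
        have "norm (g s - h s) \<le> dist g h" using dist_bounded[of g s h] by (simp add: dist_norm)
        then show ?thesis using YL[of "g s" "h s"] L(1) by (smt (verit) mult_left_mono)
      qed
    qed (use that in auto)
    also have "\<dots> \<le> (L * dist g h) * (2 * \<tau>)" using that L(1) by (intro mult_left_mono) auto
    finally show ?thesis by (simp add: mult.commute)
  qed
  have z: "0 \<in> {-\<tau>..\<tau>}" using \<tau>(1) by simp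
  have Fb: "F (apply_bcontfun g) \<in> bcontfun" for g
  proof -
    have "continuous_on {-\<tau>..\<tau>} (J (apply_bcontfun g))"
      unfolding J_def[abs_def] by (rule indefinite_integral_continuous_1[OF int])
    then have "continuous_on UNIV (\<lambda>t. J (apply_bcontfun g) (c t))"
      by (rule continuous_on_compose2) (auto simp: c_def intro!: continuous_intros c[unfolded c_def])
    then have "continuous_on UNIV (F (apply_bcontfun g))"
      unfolding F_def[abs_def] by (intro continuous_intros)
    moreover have "norm (F (apply_bcontfun g) t) \<le> norm u0 + 4 * \<tau> * M" for t
      using Jle[OF c[of t], of g] Jle[OF z, of g] unfolding F_def by (norm)
    ultimately show ?thesis by (rule bcontfun_normI)
  qed
  define T where "T g = Bcontfun (F (apply_bcontfun g))" for g
  have T: "apply_bcontfun (T g) = F (apply_bcontfun g)" for g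
    unfolding T_def by (rule Bcontfun_inverse[OF Fb])
  have "dist (T g) (T h) \<le> 1 / 2 * dist g h" for g h
  proof (rule dist_bound)
    fix t
    have "dist (T g t) (T h t) \<le> 4 * \<tau> * L * dist g h"
      using JL[OF c[of t], of g h] JL[OF z, of g h] unfolding T F_def dist_norm by (norm)
    also have "\<dots> \<le> 1 / 2 * dist g h" using \<tau>(3) by (intro mult_right_mono) auto
    finally show "dist (T g t) (T h t) \<le> 1 / 2 * dist g h" .
  qed
  then obtain g where "T g = g" using banach_fix_type[of "1/2" T] by auto
  then have g: "apply_bcontfun g t = F (apply_bcontfun g) t" for t using T[of g] by simp
  show thesis
  proof (rule that[OF \<tau>(1)])
    show "apply_bcontfun g 0 = u0" using g[of 0] z by (simp add: F_def c_def)
    fix t assume t: "t \<in> {-\<tau><..<\<tau>}"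
    have "norm (g t - u0) \<le> 4 * \<tau> * M"
      using Jle[OF c[of t], of g] Jle[OF z, of g] unfolding g[of t] F_def by norm
    then have gK: "g t \<in> ?K" using \<tau>(2) by (simp add: dist_norm norm_minus_commute)
    then have Yg: "Y (g t) = X (g t)" by (simp add: Y_def closest_point_self)
    have "(J (apply_bcontfun g) has_vector_derivative Y (g t)) (at t within {-\<tau>..\<tau>})"
      unfolding J_def[abs_def] using t
      by (intro integral_has_vector_derivative Ycont continuous_on_apply_bcontfun) auto
    then have "(J (apply_bcontfun g) has_vector_derivative Y (g t)) (at t)"
      using t at_within_interior[of t "{-\<tau>..\<tau>}"] by (simp add: interior_atLeastAtMost_real)
    then have "((\<lambda>t. u0 + (J (apply_bcontfun g) t - J (apply_bcontfun g) 0)) has_vector_derivative 0 + (Y (g t) - 0)) (at t)"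
      by (intro derivative_intros)
    then have "((\<lambda>t. u0 + (J (apply_bcontfun g) t - J (apply_bcontfun g) 0)) has_vector_derivative X (g t)) (at t)"
      by (simp add: Yg)
    then have "(apply_bcontfun g has_vector_derivative X (g t)) (at t)"
    proof (rule has_vector_derivative_transform_within_open[OF _ _ t])
      show "u0 + (J (apply_bcontfun g) s - J (apply_bcontfun g) 0) = apply_bcontfun g s" if "s \<in> {-\<tau><..<\<tau>}" for s
        using that unfolding g[of s] F_def by (simp add: c_def)
    qed simp
    then show "g t \<in> U \<and> (apply_bcontfun g has_vector_derivative X (g t)) (at t)" using gK r by auto
  qed
qed

section \<open>Consequence of straight integral curves for the field\<close>

text \<open>If \<open>n\<close> is orthogonal to the direction \<open>w\<close> of the orbit, then
  \<open>\<gamma> t \<bullet> n\<close> is constant in \<open>t\<close>. Its first two derivatives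
  at 0 show that \<open>X u0\<close> and \<open>along X X u0\<close> are orthogonal to every such
  \<open>n\<close>, so both are multiples of \<open>w\<close>.\<close>

lemma straight_orbit_parallel:
  fixes X :: "'a::euclidean_space \<Rightarrow> 'a"
  assumes "open U" "u0 \<in> U" and X: "smooth_on U X" and "X u0 \<noteq> 0"
    and coll: "\<And>I \<gamma>. integral_curve_on U X I \<gamma> \<Longrightarrow> collinear (\<gamma> ` I)"
  obtains \<mu> where "along X X u0 = \<mu> *\<^sub>R X u0"
proof -
  obtain \<tau> \<gamma> where \<gamma>: "\<tau> > 0" "\<gamma> 0 = u0"
    "\<And>t. t \<in> {-\<tau><..<\<tau>} \<Longrightarrow> \<gamma> t \<in> U \<and> (\<gamma> has_vector_derivative X (\<gamma> t)) (at t)"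
    using local_flow_exists[OF assms(1-3)] by metis
  let ?I = "{-\<tau><..<\<tau>}"
  have I: "open ?I" "0 \<in> ?I" using \<gamma>(1) by auto
  have "integral_curve_on U X ?I \<gamma>"
    using \<gamma> by (auto simp: integral_curve_on_def is_interval_oo)
  from coll[OF this] obtain w where w: "\<And>s t. s \<in> ?I \<Longrightarrow> t \<in> ?I \<Longrightarrow> \<exists>c. \<gamma> s - \<gamma> t = c *\<^sub>R w"
    unfolding collinear_def by blast
  have zero_der: "d = 0" if "(h has_real_derivative d) (at t)" "t \<in> ?I" "\<And>s. s \<in> ?I \<Longrightarrow> h s = k" for h d t k
    using DERIV_unique[OF that(1)] has_field_derivative_transform_within_open[OF DERIV_const I(1) that(2)] that(3)
    by metis
  have perp: "X (\<gamma> t) \<bullet> n = 0" if "t \<in> ?I" "n \<bullet> w = 0" for t n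
  proof (rule zero_der[OF _ that(1)])
    show "((\<lambda>t. \<gamma> t \<bullet> n) has_real_derivative X (\<gamma> t) \<bullet> n) (at t)"
      using bounded_linear.has_vector_derivative[OF bounded_linear_inner_left, of \<gamma> _ "at t" n] \<gamma>(3)[OF that(1)]
      by (simp add: has_real_derivative_iff_has_vector_derivative)
    show "\<gamma> s \<bullet> n = \<gamma> 0 \<bullet> n" if "s \<in> ?I" for s
      using w[OF that I(2)] \<open>n \<bullet> w = 0\<close> by (metis eq_iff_diff_eq_0 inner_commute inner_diff_left inner_scaleR_right mult_zero_right)
  qed
  have perp2: "along X X u0 \<bullet> n = 0" if "n \<bullet> w = 0" for n
  proof (rule zero_der[OF _ I(2)])
    have "(\<gamma> has_derivative (\<lambda>h. h *\<^sub>R X u0)) (at 0)"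
      using \<gamma>(3)[OF I(2)] by (simp add: \<gamma>(2) has_vector_derivative_def)
    moreover have "(X has_derivative (\<lambda>x. dir_deriv X x u0)) (at (\<gamma> 0))"
      using has_derivative_dir_deriv[OF smooth_on_differentiable[OF X assms(2)]] by (simp add: \<gamma>(2))
    ultimately have "((\<lambda>t. X (\<gamma> t)) has_derivative (\<lambda>h. dir_deriv X (h *\<^sub>R X u0) u0)) (at 0)"
      by (rule has_derivative_compose)
    moreover have "dir_deriv X (h *\<^sub>R X u0) u0 = h *\<^sub>R along X X u0" for h
      using linear_cmul[OF linear_dir_deriv1[OF assms(1) X assms(2)]] by (simp add: along_def)
    ultimately have "((\<lambda>t. X (\<gamma> t)) has_vector_derivative along X X u0) (at 0)"
      by (simp add: has_vector_derivative_def)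
    then show "((\<lambda>t. X (\<gamma> t) \<bullet> n) has_real_derivative along X X u0 \<bullet> n) (at 0)"
      using bounded_linear.has_vector_derivative[OF bounded_linear_inner_left, of _ _ "at 0" n]
      by (simp add: has_real_derivative_iff_has_vector_derivative)
  qed (rule perp[OF _ that])
  \<comment> \<open>For \<open>w = 0\<close> the quotient is 0 by convention and \<open>?n\<close>
    is \<open>x\<close>, so the computation below gives \<open>x = 0\<close>.\<close>
  have par: "x = ((x \<bullet> w) / (w \<bullet> w)) *\<^sub>R w" if "\<And>n. n \<bullet> w = 0 \<Longrightarrow> x \<bullet> n = 0" for x
  proof -
    let ?n = "x - ((x \<bullet> w) / (w \<bullet> w)) *\<^sub>R w"
    have nw: "?n \<bullet> w = 0" by (cases "w = 0") (simp_all add: inner_diff_left)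
    have "?n \<bullet> ?n = x \<bullet> ?n - ((x \<bullet> w) / (w \<bullet> w)) * (?n \<bullet> w)"
      by (simp add: inner_diff_left inner_diff_right inner_commute)
    then have "?n \<bullet> ?n = 0" using that[OF nw] nw by simp
    then show ?thesis by simp
  qed
  have X0: "X u0 = ((X u0 \<bullet> w) / (w \<bullet> w)) *\<^sub>R w" by (rule par) (use perp[OF I(2)] in \<open>simp add: \<gamma>(2)\<close>)
  have a0: "along X X u0 = ((along X X u0 \<bullet> w) / (w \<bullet> w)) *\<^sub>R w" by (rule par) (rule perp2)
  define x where "x = (X u0 \<bullet> w) / (w \<bullet> w)"
  have "x \<noteq> 0" using X0 \<open>X u0 \<noteq> 0\<close> by (auto simp: x_def)
  then have "w = (1 / x) *\<^sub>R X u0" using X0 by (metis x_def scaleR_one divide_self_if scaleR_scaleR times_divide_eq_left mult_1)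
  then show thesis using a0 that by (metis scaleR_scaleR)
qed

section \<open>The coframe of three eigenvectors\<close>

unbundle cross3_syntax

text \<open>The operator (M - m)(M - n) kills \<open>b\<close> and \<open>c\<close> and multiplies
  \<open>a\<close> by the nonzero number (l - m)(l - n).\<close>

lemma eigenvectors_independent_aux:
  fixes M :: "'a::real_vector \<Rightarrow> 'a"
  assumes "linear M" "M a = l *\<^sub>R a" "M b = m *\<^sub>R b" "M c = n *\<^sub>R c" "l \<noteq> m" "l \<noteq> n" "a \<noteq> 0"
    and 0: "x *\<^sub>R a + y *\<^sub>R b + z *\<^sub>R c = 0"
  shows "x = 0"
proof -
  have M: "M (p *\<^sub>R a + q *\<^sub>R b + r *\<^sub>R c) = (l * p) *\<^sub>R a + (m * q) *\<^sub>R b + (n * r) *\<^sub>R c" for p q r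
    by (simp add: linear_add[OF assms(1)] linear_cmul[OF assms(1)] assms(2-4) mult.commute)
  have 1: "(l * x) *\<^sub>R a + (m * y) *\<^sub>R b + (n * z) *\<^sub>R c = 0"
    using M[of x y z] 0 linear_0[OF assms(1)] by simp
  have 2: "(l * (l * x)) *\<^sub>R a + (m * (m * y)) *\<^sub>R b + (n * (n * z)) *\<^sub>R c = 0"
    using M[of "l * x" "m * y" "n * z"] 1 linear_0[OF assms(1)] by simp
  have "((l - m) * (l - n) * x) *\<^sub>R a
    = ((l * (l * x)) *\<^sub>R a + (m * (m * y)) *\<^sub>R b + (n * (n * z)) *\<^sub>R c)
      - (m + n) *\<^sub>R ((l * x) *\<^sub>R a + (m * y) *\<^sub>R b + (n * z) *\<^sub>R c)
      + (m * n) *\<^sub>R (x *\<^sub>R a + y *\<^sub>R b + z *\<^sub>R c)"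
    by (simp add: algebra_simps)
  then show ?thesis using 0 1 2 assms(5-7) by simp
qed

text \<open>The triple product is the determinant of the matrix with columns \<open>a\<close>,
  \<open>b\<close>, \<open>c\<close>, and independence says that its kernel is trivial.\<close>

lemma triple_product_nonzero:
  fixes a b c :: "real^3"
  assumes "\<And>x y z. x *\<^sub>R a + y *\<^sub>R b + z *\<^sub>R c = 0 \<Longrightarrow> x = 0 \<and> y = 0 \<and> z = 0"
  shows "a \<bullet> (b \<times> c) \<noteq> 0"
proof -
  let ?A = "transpose (vector [a, b, c] :: real^3^3)"
  have "?A *v w = w $ 1 *\<^sub>R a + w $ 2 *\<^sub>R b + w $ 3 *\<^sub>R c" for w
    by (simp add: vec_eq_iff matrix_vector_mult_def transpose_def sum_3 vector_3 mult.commute)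
  then have "w = 0" if "?A *v w = 0" for w
    using assms[of "w $ 1" "w $ 2" "w $ 3"] that by (simp add: vec_eq_iff forall_3)
  then have "det ?A \<noteq> 0"
    using matrix_left_invertible_ker[of ?A] invertible_left_inverse[of ?A] invertible_det_nz[of ?A] by blast
  then show ?thesis by (simp add: dot_cross_det det_transpose)
qed

text \<open>Cramer's rule in dimension three.\<close>

lemma triple_product_expand:
  fixes a b c x :: "real^3"
  shows "(a \<bullet> (b \<times> c)) *\<^sub>R x = ((b \<times> c) \<bullet> x) *\<^sub>R a + ((c \<times> a) \<bullet> x) *\<^sub>R b + ((a \<times> b) \<bullet> x) *\<^sub>R c"
  by (simp add: vec_eq_iff forall_3 cross3_def inner_vec_def sum_3 vector_3) (auto simp: algebra_simps)

lemma triple_product_cyclic: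
  fixes a b c :: "real^3"
  shows "(b \<times> c) \<bullet> a = a \<bullet> (b \<times> c)" "(c \<times> a) \<bullet> b = a \<bullet> (b \<times> c)" "(a \<times> b) \<bullet> c = a \<bullet> (b \<times> c)"
  by (simp_all add: cross3_def inner_vec_def sum_3 vector_3 algebra_simps)

lemmas smooth_on_cross = smooth_on_bilinear[OF bilinear_conv_bounded_bilinear[THEN iffD1, OF bilinear_cross]]

text \<open>The coframe is the reciprocal basis: cross products of two frame vectors divided by the
  triple product, hence smooth.\<close>

lemma dual_frame_exists:
  fixes \<xi> :: "3 \<Rightarrow> real^3 \<Rightarrow> real^3"
  assumes V: "open V" and \<xi>: "\<And>i. smooth_on V (\<xi> i)"
    and nz: "\<And>u. u \<in> V \<Longrightarrow> \<xi> 1 u \<bullet> (\<xi> 2 u \<times> \<xi> 3 u) \<noteq> 0"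
  obtains \<omega> :: "3 \<Rightarrow> real^3 \<Rightarrow> real^3" where "\<And>i. smooth_on V (\<omega> i)"
    "\<And>u k i. u \<in> V \<Longrightarrow> \<omega> k u \<bullet> \<xi> i u = (if k = i then 1 else 0)"
    "\<And>u x. u \<in> V \<Longrightarrow> x = (\<Sum>k\<in>UNIV. (\<omega> k u \<bullet> x) *\<^sub>R \<xi> k u)"
proof -
  define \<Delta> where "\<Delta> u = \<xi> 1 u \<bullet> (\<xi> 2 u \<times> \<xi> 3 u)" for u
  define \<omega> :: "3 \<Rightarrow> real^3 \<Rightarrow> real^3" where "\<omega> k u = inverse (\<Delta> u) *\<^sub>R
    (if k = 1 then \<xi> 2 u \<times> \<xi> 3 u else if k = 2 then \<xi> 3 u \<times> \<xi> 1 u else \<xi> 1 u \<times> \<xi> 2 u)" for k u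
  have \<Delta>: "\<Delta> u \<noteq> 0" if "u \<in> V" for u using nz[OF that] by (simp add: \<Delta>_def)
  have "smooth_on V \<Delta>"
    unfolding \<Delta>_def[abs_def] by (rule smooth_on_inner[OF V \<xi> smooth_on_cross[OF V \<xi> \<xi>]])
  then have "smooth_on V (\<lambda>u. inverse (\<Delta> u))" using smooth_on_inverse[OF V] \<Delta> by blast
  then have "smooth_on V (\<lambda>u. inverse (\<Delta> u) *\<^sub>R (\<xi> i u \<times> \<xi> j u))" for i j
    by (rule smooth_on_scaleR[OF V _ smooth_on_cross[OF V \<xi> \<xi>]])
  then have "smooth_on V (\<omega> k)" for k
    using exhaust_3[of k] unfolding \<omega>_def[abs_def] by auto
  moreover have "\<omega> k u \<bullet> \<xi> i u = (if k = i then 1 else 0)" if "u \<in> V" for u k i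
    using exhaust_3[of k] exhaust_3[of i] \<Delta>[OF that]
    by (elim disjE) (simp_all add: \<omega>_def triple_product_cyclic[where a = "\<xi> 1 u" and b = "\<xi> 2 u" and c = "\<xi> 3 u"] dot_cross_self \<Delta>_def)
  moreover have "x = (\<Sum>k\<in>UNIV. (\<omega> k u \<bullet> x) *\<^sub>R \<xi> k u)" if "u \<in> V" for u x
  proof -
    have "(\<Sum>k\<in>UNIV. (\<omega> k u \<bullet> x) *\<^sub>R \<xi> k u) = inverse (\<Delta> u) *\<^sub>R (\<Delta> u *\<^sub>R x)"
      unfolding \<Delta>_def triple_product_expand unfolding \<Delta>_def[symmetric]
      by (simp add: sum_3 \<omega>_def scaleR_add_right)
    then show ?thesis using \<Delta>[OF that] by simp
  qed
  ultimately show thesis using that by blast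
qed

section \<open>Construction of the frame near a point\<close>

text \<open>The scaled field has component \<open>m\<close> identically 1, so its derivative has
  component \<open>m\<close> equal to 0. That derivative is a multiple of \<open>X u\<close>, whose
  component \<open>m\<close> is nonzero, and therefore vanishes.\<close>

lemma normalised_field_straight:
  fixes X :: "real^'n \<Rightarrow> real^'n"
  assumes V: "open V" and u: "u \<in> V" and X: "smooth_on V X" and nz: "\<And>v. v \<in> V \<Longrightarrow> X v $ m \<noteq> 0"
    and par: "along X X u = \<mu> *\<^sub>R X u"
  shows "along (\<lambda>v. inverse (X v $ m) *\<^sub>R X v) (\<lambda>v. inverse (X v $ m) *\<^sub>R X v) u = 0"
proof -
  let ?\<phi> = "\<lambda>v. inverse (X v $ m)"
  let ?Y = "\<lambda>v. ?\<phi> v *\<^sub>R X v"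
  have \<phi>: "smooth_on V ?\<phi>" by (rule smooth_on_inverse[OF V smooth_on_vec_nth[OF V X] nz])
  have Y: "smooth_on V ?Y" by (rule smooth_on_scaleR[OF V \<phi> X])
  have "along ?Y ?Y u = ?\<phi> u *\<^sub>R along X ?Y u"
    using linear_cmul[OF linear_dir_deriv1[OF V Y u]] by (simp add: along_def)
  also have "\<dots> = (?\<phi> u * (?\<phi> u * \<mu> + along X ?\<phi> u)) *\<^sub>R X u"
    by (simp add: along_scaleR[OF u \<phi> X] par algebra_simps)
  finally obtain \<nu> where \<nu>: "along ?Y ?Y u = \<nu> *\<^sub>R X u" by blast
  have "along ?Y ?Y u $ m = along ?Y (\<lambda>v. ?Y v $ m) u"
    unfolding along_def
    by (rule dir_deriv_linear_comp[OF bounded_linear_vec_nth smooth_on_differentiable[OF Y u], symmetric])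
  also have "\<dots> = along ?Y (\<lambda>v. 1) u"
    by (rule along_cong[OF V u]) (simp add: nz)
  finally have "\<nu> = 0" using \<nu> nz[OF u] by (simp add: along_const)
  then show ?thesis using \<nu> by simp
qed

lemma T_frame_exists:
  fixes f :: "real^3 \<Rightarrow> real^3"
  assumes U: "open U" and T: "T_system_on U f" and u0: "u0 \<in> U"
  obtains V lam \<xi> \<omega> where "u0 \<in> V" "V \<subseteq> U" "T_frame V f lam \<xi> \<omega>"
proof -
  obtain lam xi where cf: "characteristic_fields U f lam xi"
    and coll: "\<And>i I \<gamma>. integral_curve_on U (xi i) I \<gamma> \<Longrightarrow> collinear (\<gamma> ` I)"
    and lc: "\<And>i u. u \<in> U \<Longrightarrow> along (xi i) (lam i) u = 0"
    using T unfolding T_system_on_def along_def dir_deriv_def by blast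
  have f: "smooth_on U f" using T by (simp add: T_system_on_def)
  have lam: "smooth_on U (lam i)" and xi: "smooth_on U (xi i)" for i
    using cf by (auto simp: characteristic_fields_def)
  have dist: "lam i u \<noteq> lam j u" if "u \<in> U" "i \<noteq> j" for u i j
    using cf that by (auto simp: characteristic_fields_def inj_def)
  have xi0: "xi i u \<noteq> 0" if "u \<in> U" for u i using cf that by (auto simp: characteristic_fields_def)
  have eig: "dir_deriv f (xi i u) u = lam i u *\<^sub>R xi i u" if "u \<in> U" for u i
  proof -
    have "(f has_derivative (\<lambda>h. jacobian f (at u) *v h)) (at u)"
      using smooth_on_differentiable[OF f that] jacobian_works by blast
    then show ?thesis using cf that by (simp add: dir_deriv_eqI characteristic_fields_def)
  qed
  \<comment> \<open>Each family has its own component \<open>m i\<close> for the scaling;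
    \<open>V\<close> is the open set where none of these components vanishes.\<close>
  have "\<exists>m. xi i u0 $ m \<noteq> 0" for i using xi0[OF u0, of i] by (simp add: vec_eq_iff)
  then obtain m where m: "\<And>i. xi i u0 $ m i \<noteq> 0" by metis
  define V where "V = (\<Inter>i. U \<inter> (\<lambda>u. xi i u $ m i) -` (- {0}))"
  have "open (U \<inter> (\<lambda>u. xi i u $ m i) -` (- {0}))" for i
    by (rule continuous_open_preimage[OF smooth_on_continuous_on[OF smooth_on_vec_nth[OF U xi]] U]) auto
  then have "open V" unfolding V_def by (intro open_INT) auto
  have VU: "V \<subseteq> U" and "u0 \<in> V" and nz: "\<And>i u. u \<in> V \<Longrightarrow> xi i u $ m i \<noteq> 0"
    using m u0 by (auto simp: V_def)
  note sm = smooth_on_subset[OF _ VU]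
  define \<xi> where "\<xi> i u = inverse (xi i u $ m i) *\<^sub>R xi i u" for i u
  have s\<xi>: "smooth_on V (\<xi> i)" for i
    unfolding \<xi>_def[abs_def]
    by (rule smooth_on_scaleR[OF \<open>open V\<close> smooth_on_inverse[OF \<open>open V\<close> smooth_on_vec_nth[OF \<open>open V\<close> sm[OF xi]] nz] sm[OF xi]])
  have lin: "linear (\<lambda>x. dir_deriv f x u)" if "u \<in> V" for u
    using linear_dir_deriv1[OF U f] that VU by blast
  have eigen: "dir_deriv f (\<xi> i u) u = lam i u *\<^sub>R \<xi> i u" if "u \<in> V" for u i
    using eig[of u i] that VU by (simp add: \<xi>_def linear_cmul[OF lin[OF that]] subset_iff)
  have \<xi>0: "\<xi> i u \<noteq> 0" if "u \<in> V" for i u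
    using nz[OF that] xi0[of u i] that VU by (auto simp: \<xi>_def)
  have "\<xi> 1 u \<bullet> (\<xi> 2 u \<times> \<xi> 3 u) \<noteq> 0" if u: "u \<in> V" for u
  proof (rule triple_product_nonzero)
    fix x y z assume 0: "x *\<^sub>R \<xi> 1 u + y *\<^sub>R \<xi> 2 u + z *\<^sub>R \<xi> 3 u = 0"
    have d: "lam i u \<noteq> lam j u" if "i \<noteq> j" for i j using dist u VU that by blast
    have d': "lam 1 u \<noteq> lam 2 u" "lam 1 u \<noteq> lam 3 u" "lam 2 u \<noteq> lam 3 u"
      by (rule d, simp)+
    note aux = eigenvectors_independent_aux[OF lin[OF u] eigen[OF u] eigen[OF u] eigen[OF u] _ _ \<xi>0[OF u]]
    have "x = 0" by (rule aux[of 1 2 3 x y z]) (use d' 0 in auto)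
    moreover have "y = 0" by (rule aux[of 2 1 3 y x z]) (use d' 0 in \<open>auto simp: algebra_simps\<close>)
    moreover have "z = 0" by (rule aux[of 3 1 2 z x y]) (use d' 0 in \<open>auto simp: algebra_simps\<close>)
    ultimately show "x = 0 \<and> y = 0 \<and> z = 0" by simp
  qed
  then obtain \<omega> :: "3 \<Rightarrow> real^3 \<Rightarrow> real^3" where \<omega>: "\<And>i. smooth_on V (\<omega> i)"
    "\<And>u k i. u \<in> V \<Longrightarrow> \<omega> k u \<bullet> \<xi> i u = (if k = i then 1 else 0)"
    "\<And>u x. u \<in> V \<Longrightarrow> x = (\<Sum>k\<in>UNIV. (\<omega> k u \<bullet> x) *\<^sub>R \<xi> k u)"
    using dual_frame_exists[OF \<open>open V\<close>, of \<xi>, OF s\<xi>] by blast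
  have lam_const: "along (\<xi> i) (lam i) u = 0" if "u \<in> V" for i u
    using lc[of u i] linear_cmul[OF linear_dir_deriv1[OF U lam, of u i]] that VU
    by (auto simp: along_def \<xi>_def)
  have straight: "along (\<xi> i) (\<xi> i) u = 0" if "u \<in> V" for i u
  proof -
    have "u \<in> U" using that VU by blast
    obtain \<mu> where "along (xi i) (xi i) u = \<mu> *\<^sub>R xi i u"
      using straight_orbit_parallel[OF U \<open>u \<in> U\<close> xi[of i] xi0[OF \<open>u \<in> U\<close>] coll[of i]] by blast
    from normalised_field_straight[OF \<open>open V\<close> that sm[OF xi] nz this] show ?thesis
      unfolding \<xi>_def[abs_def] .
  qed
  have "T_frame V f lam \<xi> \<omega>"
    by (rule T_frame.intro)
      (fact \<open>open V\<close> sm[OF f] sm[OF lam] s\<xi> \<omega> eigen dist[OF subsetD[OF VU]] lam_const straight)+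
  with \<open>u0 \<in> V\<close> VU that show thesis by blast
qed

unbundle no cross3_syntax

section \<open>Derivatives of the Pluecker coordinates\<close>

definition wedge :: "real^'n \<Rightarrow> real^'n \<Rightarrow> real^'n^'n" where
  "wedge x y = (\<chi> i j. x $ i * y $ j - x $ j * y $ i)"

lemma wedge_self: "wedge x x = 0"
  by (simp add: wedge_def vec_eq_iff)

lemma wedge_skew: "wedge x y = - wedge y x"
  by (simp add: wedge_def vec_eq_iff)

lemma bounded_bilinear_wedge: "bounded_bilinear (wedge :: real^'n \<Rightarrow> _)"
proof -
  have "bilinear (wedge :: real^'n \<Rightarrow> _)"
    unfolding bilinear_def
    by (auto intro!: linearI simp: wedge_def vec_eq_iff algebra_simps)
  then show ?thesis by (simp add: bilinear_conv_bounded_bilinear)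
qed

lemma bounded_bilinear_inner_wedge: "bounded_bilinear (\<lambda>x y. C \<bullet> wedge x y)"
proof -
  interpret bounded_bilinear "wedge :: real^'n \<Rightarrow> _" by (rule bounded_bilinear_wedge)
  have "bilinear (\<lambda>x y. C \<bullet> wedge x y)"
    unfolding bilinear_def
    by (auto intro!: linearI simp: add_left add_right scaleR_left scaleR_right inner_add_right)
  then show ?thesis by (simp add: bilinear_conv_bounded_bilinear)
qed

text \<open>The pairing of \<open>plucker_coords f u\<close> with a covector \<open>(\<alpha>, a, b, C)\<close>.\<close>

definition plucker_form :: "real \<Rightarrow> real^'n \<Rightarrow> real^'n \<Rightarrow> real^'n^'n \<Rightarrow> (real^'n \<Rightarrow> real^'n) \<Rightarrow> real^'n \<Rightarrow> real" where
  "plucker_form \<alpha> a b C f u = \<alpha> + a \<bullet> u + b \<bullet> f u + C \<bullet> wedge u (f u)"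

context
  fixes U :: "(real^'n) set" and f :: "real^'n \<Rightarrow> real^'n" and \<alpha> :: real and a b :: "real^'n" and C :: "real^'n^'n"
  assumes U: "open U" and f: "smooth_on U f"
begin

lemma smooth_plucker_form: "smooth_on U (plucker_form \<alpha> a b C f)"
  unfolding plucker_form_def[abs_def]
  by (intro smooth_on_add[OF U] smooth_on_inner[OF U] smooth_on_const smooth_on_ident f
      smooth_on_bilinear[OF bounded_bilinear_inner_wedge U])

interpretation W: bounded_bilinear "\<lambda>x y. C \<bullet> wedge x y"
  by (rule bounded_bilinear_inner_wedge)

lemma plucker_form_deriv1:
  assumes u: "u \<in> U"
  shows "dir_deriv (plucker_form \<alpha> a b C f) x u = a \<bullet> x + b \<bullet> dir_deriv f x u + C \<bullet> wedge x (f u) + C \<bullet> wedge u (dir_deriv f x u)"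
proof -
  have "(plucker_form \<alpha> a b C f has_derivative (\<lambda>x. 0 + a \<bullet> x + b \<bullet> dir_deriv f x u
      + (C \<bullet> wedge u (dir_deriv f x u) + C \<bullet> wedge x (f u)))) (at u)"
    unfolding plucker_form_def[abs_def]
    by (intro has_derivative_add has_derivative_const has_derivative_inner_right has_derivative_ident
        W.FDERIV has_derivative_dir_deriv smooth_on_differentiable[OF f u])
  from dir_deriv_eqI[OF this, of x] show ?thesis by simp
qed

lemma plucker_form_deriv2:
  assumes u: "u \<in> U"
  shows "dir_deriv (dir_deriv (plucker_form \<alpha> a b C f) x) y u = b \<bullet> dir_deriv (dir_deriv f x) y u
    + C \<bullet> wedge x (dir_deriv f y u) + C \<bullet> wedge y (dir_deriv f x u)
    + C \<bullet> wedge u (dir_deriv (dir_deriv f x) y u)"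
proof -
  let ?d = "\<lambda>u. a \<bullet> x + b \<bullet> dir_deriv f x u + C \<bullet> wedge x (f u) + C \<bullet> wedge u (dir_deriv f x u)"
  have "(?d has_derivative (\<lambda>y. 0 + b \<bullet> dir_deriv (dir_deriv f x) y u
      + (C \<bullet> wedge x (dir_deriv f y u) + C \<bullet> wedge 0 (f u))
      + (C \<bullet> wedge u (dir_deriv (dir_deriv f x) y u) + C \<bullet> wedge y (dir_deriv f x u)))) (at u)"
    by (intro has_derivative_add has_derivative_const has_derivative_inner_right has_derivative_ident
        W.FDERIV has_derivative_dir_deriv smooth_on_differentiable[OF _ u] smooth_on_dir_deriv f)
  from dir_deriv_eqI[OF this, of y] dir_deriv_cong[OF U u, of "dir_deriv (plucker_form \<alpha> a b C f) x" ?d y, OF plucker_form_deriv1] show ?thesis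
    by (simp add: W.zero_left)
qed

lemma plucker_form_deriv3:
  assumes u: "u \<in> U"
  shows "dir_deriv (dir_deriv (dir_deriv (plucker_form \<alpha> a b C f) x) y) z u = b \<bullet> dir_deriv (dir_deriv (dir_deriv f x) y) z u
    + C \<bullet> wedge x (dir_deriv (dir_deriv f y) z u) + C \<bullet> wedge y (dir_deriv (dir_deriv f x) z u)
    + C \<bullet> wedge z (dir_deriv (dir_deriv f x) y u) + C \<bullet> wedge u (dir_deriv (dir_deriv (dir_deriv f x) y) z u)"
proof -
  let ?d = "\<lambda>u. b \<bullet> dir_deriv (dir_deriv f x) y u
    + C \<bullet> wedge x (dir_deriv f y u) + C \<bullet> wedge y (dir_deriv f x u)
    + C \<bullet> wedge u (dir_deriv (dir_deriv f x) y u)"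
  have "(?d has_derivative (\<lambda>z. b \<bullet> dir_deriv (dir_deriv (dir_deriv f x) y) z u
      + (C \<bullet> wedge x (dir_deriv (dir_deriv f y) z u) + C \<bullet> wedge 0 (dir_deriv f y u))
      + (C \<bullet> wedge y (dir_deriv (dir_deriv f x) z u) + C \<bullet> wedge 0 (dir_deriv f x u))
      + (C \<bullet> wedge u (dir_deriv (dir_deriv (dir_deriv f x) y) z u) + C \<bullet> wedge z (dir_deriv (dir_deriv f x) y u)))) (at u)"
    by (intro has_derivative_add has_derivative_const has_derivative_inner_right has_derivative_ident
        W.FDERIV has_derivative_dir_deriv smooth_on_differentiable[OF _ u] smooth_on_dir_deriv f)
  from dir_deriv_eqI[OF this, of z] dir_deriv_cong[OF U u, of "dir_deriv (dir_deriv (plucker_form \<alpha> a b C f) x) y" ?d z, OF plucker_form_deriv2] show ?thesis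
    by (simp add: W.zero_left)
qed

end

section \<open>Second and third derivatives of a Pluecker form in the frame\<close>

context T_frame
begin

context
  fixes \<alpha> :: real and a b :: "real^3" and C :: "real^3^3"
begin

abbreviation (input) "\<Phi> \<equiv> plucker_form \<alpha> a b C f"

definition hess :: "3 \<Rightarrow> 3 \<Rightarrow> real^3 \<Rightarrow> real" where
  "hess i j u = dir_deriv (dir_deriv \<Phi> (\<xi> i u)) (\<xi> j u) u"

definition cubic :: "3 \<Rightarrow> 3 \<Rightarrow> 3 \<Rightarrow> real^3 \<Rightarrow> real" where
  "cubic i j k u = dir_deriv (dir_deriv (dir_deriv \<Phi> (\<xi> i u)) (\<xi> j u)) (\<xi> k u) u"

interpretation W: bounded_bilinear "\<lambda>x y. C \<bullet> wedge x y"
  by (rule bounded_bilinear_inner_wedge)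

lemma W_skew: "C \<bullet> wedge y x = - (C \<bullet> wedge x y)"
  using wedge_skew[of y x] by simp

text \<open>The eigenvector equation turns the mixed terms into multiples of the wedge of
  \<open>\<xi> i\<close> and \<open>\<xi> j\<close>, which skew symmetry combines into one.\<close>

lemma hess_eq:
  assumes u: "u \<in> V"
  shows "hess i j u = b \<bullet> Q i j u + C \<bullet> wedge u (Q i j u)
    + (lam j u - lam i u) * (C \<bullet> wedge (\<xi> i u) (\<xi> j u))"
  unfolding hess_def plucker_form_deriv2[OF V smooth_f u] eigen[OF u]
  by (simp add: Q_def W.scaleR_right W_skew[of "\<xi> j u" "\<xi> i u"] algebra_simps)

lemma hess_diag: "u \<in> V \<Longrightarrow> hess i i u = 0"
  by (simp add: hess_eq Q_diag W.zero_right)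

text \<open>The \<open>\<xi> i\<close>-component of \<open>Q j k\<close> is lost in the wedge with
  \<open>\<xi> i\<close>; the other two are eigenvalue derivatives.\<close>

lemma W_Q:
  assumes u: "u \<in> V" and ne: "i \<noteq> j" "i \<noteq> k" "j \<noteq> k"
  shows "C \<bullet> wedge (\<xi> i u) (Q j k u)
    = D k (lam j) u * (C \<bullet> wedge (\<xi> i u) (\<xi> j u)) + D j (lam k) u * (C \<bullet> wedge (\<xi> i u) (\<xi> k u))"
  using q_lam[OF u, of j k] q_lam[OF u, of k j] q_commute[OF u, of j j k]
  by (simp add: Q_expand[OF u, of j k] sum_3_distinct[OF ne] W.add_right W.scaleR_right wedge_self)

text \<open>Carries \<open>third_derivative\<close> over from \<open>f\<close> to the Pluecker
  coordinates. By \<open>W_Q\<close> the extra wedges come with differences of eigenvalue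
  derivatives, which are \<open>coef\<close> times the eigenvalue differences appearing in
  \<open>hess_eq\<close>.\<close>

lemma cubic_distinct:
  assumes u: "u \<in> V" and ne: "i \<noteq> j" "i \<noteq> k" "j \<noteq> k"
  shows "cubic i j k u = coef i j k u * hess i j u + coef i k j u * hess i k u + coef j k i u * hess j k u"
proof -
  have l: "lam i u \<noteq> lam j u" "lam i u \<noteq> lam k u" "lam j u \<noteq> lam k u" using distinct[OF u] ne by auto
  have c: "coef i j k u * (lam j u - lam i u) = D k (lam j) u - D k (lam i) u"
    "coef i k j u * (lam k u - lam i u) = D j (lam k) u - D j (lam i) u"
    "coef j k i u * (lam k u - lam j u) = D i (lam k) u - D i (lam j) u"
    using l by (simp_all add: coef_def)
  have "cubic i j k u = b \<bullet> S i j k u + C \<bullet> wedge (\<xi> i u) (Q j k u) + C \<bullet> wedge (\<xi> j u) (Q i k u)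
      + C \<bullet> wedge (\<xi> k u) (Q i j u) + C \<bullet> wedge u (S i j k u)"
    unfolding cubic_def plucker_form_deriv3[OF V smooth_f u] S_def Q_def by simp
  also have "\<dots> = b \<bullet> S i j k u + C \<bullet> wedge u (S i j k u)
      + (coef i j k u * (lam j u - lam i u)) * (C \<bullet> wedge (\<xi> i u) (\<xi> j u))
      + (coef i k j u * (lam k u - lam i u)) * (C \<bullet> wedge (\<xi> i u) (\<xi> k u))
      + (coef j k i u * (lam k u - lam j u)) * (C \<bullet> wedge (\<xi> j u) (\<xi> k u))"
    unfolding c W_Q[OF u ne] W_Q[OF u ne(1)[symmetric] ne(3,2)] W_Q[OF u ne(2,3)[symmetric] ne(1)]
      W_skew[of "\<xi> j u" "\<xi> i u"] W_skew[of "\<xi> k u" "\<xi> i u"] W_skew[of "\<xi> k u" "\<xi> j u"]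
    by (simp add: algebra_simps)
  also have "\<dots> = coef i j k u * hess i j u + coef i k j u * hess i k u + coef j k i u * hess j k u"
    unfolding third_derivative[OF u ne] hess_eq[OF u]
    by (simp add: W.add_right W.scaleR_right inner_add_right algebra_simps)
  finally show ?thesis .
qed

lemma smooth_hess: "smooth_on V (hess i j)"
proof (cases "V = {}")
  case True
  then show ?thesis using smooth_on_cong[OF V _ smooth_on_const[of V 0], of "hess i j"] by blast
next
  case False
  then show ?thesis
    unfolding hess_def[abs_def]
    using dir_deriv_field2(2)[OF V smooth_plucker_form[OF V smooth_f] _ smooth_xi smooth_xi] by blast
qed

lemma hess_commute: "u \<in> V \<Longrightarrow> hess i j u = hess j i u"
  unfolding hess_def by (rule dir_deriv_commute[OF V _ smooth_plucker_form[OF V smooth_f]])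

lemma cubic_commute: "u \<in> V \<Longrightarrow> cubic i j k u = cubic j i k u" "u \<in> V \<Longrightarrow> cubic i j k u = cubic i k j u"
proof -
  assume u: "u \<in> V"
  note \<Phi> = smooth_plucker_form[OF V smooth_f]
  show "cubic i j k u = cubic i k j u"
    unfolding cubic_def by (rule dir_deriv_commute[OF V u smooth_on_dir_deriv[OF \<Phi>]])
  show "cubic i j k u = cubic j i k u"
    unfolding cubic_def by (rule dir_deriv_cong[OF V u]) (rule dir_deriv_commute[OF V _ \<Phi>])
qed

lemma D_hess:
  assumes u: "u \<in> V"
  shows "D k (hess i j) u = cubic i j k u + (\<Sum>n\<in>UNIV. \<Gamma> n k i u * hess n j u) + (\<Sum>n\<in>UNIV. \<Gamma> n k j u * hess i n u)"
proof -
  note \<Phi> = smooth_plucker_form[OF V smooth_f]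
  have l1: "linear (\<lambda>x. dir_deriv (dir_deriv \<Phi> x) y u)" for y by (rule linear_dir_deriv2[OF V \<Phi> u])
  have l2: "linear (\<lambda>y. dir_deriv (dir_deriv \<Phi> x) y u)" for x by (rule linear_dir_deriv2'[OF V \<Phi> u])
  have "D k (hess i j) u = cubic i j k u + dir_deriv (dir_deriv \<Phi> (D k (\<xi> i) u)) (\<xi> j u) u
      + dir_deriv (dir_deriv \<Phi> (\<xi> i u)) (D k (\<xi> j) u) u"
    unfolding hess_def[abs_def] cubic_def along_def by (rule dir_deriv_field2(1)[OF V \<Phi> u smooth_xi smooth_xi])
  then show ?thesis
    by (simp add: D_xi[OF u] linear_sum[OF l1] linear_cmul[OF l1] linear_sum[OF l2] linear_cmul[OF l2] hess_def)
qed

text \<open>Differentiate the identity \<open>hess_diag\<close> along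
  \<open>\<xi> k\<close>.\<close>

lemma cubic_diag:
  assumes u: "u \<in> V"
  shows "cubic i i k u = - 2 * (\<Sum>n\<in>UNIV. \<Gamma> n k i u * hess n i u)"
proof -
  have "D k (hess i i) u = 0"
    using along_cong[OF V u, of "hess i i" "\<lambda>_. 0" "\<xi> k"] hess_diag by (simp add: along_const)
  then show ?thesis using D_hess[OF u, of k i i] hess_commute[OF u, of i] by simp
qed

end

end

section \<open>Unique continuation\<close>

text \<open>A Gronwall argument: at a point \<open>m\<close> where the norm of \<open>y\<close> is
  maximal on a small ball, the mean value inequality bounds this maximum by half of itself.\<close>

lemma vanishes_near_zero:
  fixes y :: "'a::euclidean_space \<Rightarrow> 'b::euclidean_space"
  assumes y: "smooth_on V y" and r: "r > 0" "cball u r \<subseteq> V"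
    and bound: "\<And>v x. v \<in> cball u r \<Longrightarrow> norm (dir_deriv y x v) \<le> K * norm x * norm (y v)"
    and "y u = 0"
  obtains \<rho> where "\<rho> > 0" "cball u \<rho> \<subseteq> V" "\<And>v. v \<in> cball u \<rho> \<Longrightarrow> y v = 0"
proof -
  define L where "L = \<bar>K\<bar> + 1"
  have L: "L > 0" "K \<le> L" by (auto simp: L_def)
  define \<rho> where "\<rho> = min r (1 / (2 * L))"
  have \<rho>: "\<rho> > 0" "\<rho> \<le> r" "L * \<rho> \<le> 1 / 2" using r L by (auto simp: \<rho>_def min_def field_simps)
  have sub: "cball u \<rho> \<subseteq> cball u r" using \<rho> by auto
  have "continuous_on (cball u \<rho>) (\<lambda>v. norm (y v))"
    by (rule continuous_on_norm[OF continuous_on_subset[OF smooth_on_continuous_on[OF y] order_trans[OF sub r(2)]]])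
  then obtain m where m: "m \<in> cball u \<rho>" "\<And>v. v \<in> cball u \<rho> \<Longrightarrow> norm (y v) \<le> norm (y m)"
    using continuous_attains_sup[of "cball u \<rho>" "\<lambda>v. norm (y v)"] \<rho>(1) by auto
  have "norm (y m - y u) \<le> (L * norm (y m)) * norm (m - u)"
  proof (rule differentiable_bound[OF convex_cball[of u \<rho>], where f' = "\<lambda>v x. dir_deriv y x v"])
    fix v assume v: "v \<in> cball u \<rho>"
    show "(y has_derivative (\<lambda>x. dir_deriv y x v)) (at v within cball u \<rho>)"
      by (rule has_derivative_at_withinI[OF has_derivative_dir_deriv[OF smooth_on_differentiable[OF y]]])
        (use v sub r(2) in blast)
    show "onorm (\<lambda>x. dir_deriv y x v) \<le> L * norm (y m)"
    proof (rule onorm_le)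
      fix x
      have "norm (dir_deriv y x v) \<le> K * (norm x * norm (y v))" using bound[of v x] v sub by (auto simp: mult.assoc)
      also have "\<dots> \<le> L * (norm x * norm (y m))"
        using L m(2)[OF v] by (intro mult_mono mult_left_mono) simp_all
      finally show "norm (dir_deriv y x v) \<le> L * norm (y m) * norm x" by (simp add: ac_simps)
    qed
  qed (use m \<rho> in auto)
  also have "\<dots> \<le> (L * norm (y m)) * \<rho>"
    using m(1) L by (intro mult_left_mono) (auto simp: dist_norm norm_minus_commute)
  also have "\<dots> = (L * \<rho>) * norm (y m)" by simp
  also have "\<dots> \<le> 1 / 2 * norm (y m)" by (intro mult_right_mono \<rho>) auto
  finally have "norm (y m) = 0" using \<open>y u = 0\<close> by simp
  then have "y v = 0" if "v \<in> cball u \<rho>" for v using m(2)[OF that] by simp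
  then show thesis using that[OF \<rho>(1)] sub r(2) by blast
qed

lemma norm_matrix_le_sum: "norm (A :: real^'n^'m) \<le> (\<Sum>i\<in>UNIV. \<Sum>j\<in>UNIV. \<bar>A $ i $ j\<bar>)"
proof -
  have "norm A \<le> (\<Sum>i\<in>UNIV. norm (A $ i))"
    unfolding norm_vec_def[of A] by (rule L2_set_le_sum) simp
  also have "\<dots> \<le> (\<Sum>i\<in>UNIV. \<Sum>j\<in>UNIV. \<bar>A $ i $ j\<bar>)"
    by (rule sum_mono) (rule norm_le_l1_cart)
  finally show ?thesis .
qed

context T_frame
begin

context
  fixes \<alpha> :: real and a b :: "real^3" and C :: "real^3^3"
begin

abbreviation (input) "h \<equiv> hess \<alpha> a b C"

text \<open>The right side does not mention the frame, so vanishing can be compared between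
  neighbourhoods carrying different frames.\<close>

lemma hess_zero_iff:
  assumes u: "u \<in> V"
  shows "(\<forall>i j. h i j u = 0) \<longleftrightarrow> (\<forall>x y. dir_deriv (dir_deriv (plucker_form \<alpha> a b C f) x) y u = 0)"
proof
  note \<Phi> = smooth_plucker_form[OF V smooth_f, of \<alpha> a b C]
  assume 0: "\<forall>i j. h i j u = 0"
  show "\<forall>x y. dir_deriv (dir_deriv (plucker_form \<alpha> a b C f) x) y u = 0"
  proof (intro allI)
    fix x y
    have l1: "linear (\<lambda>x. dir_deriv (dir_deriv (plucker_form \<alpha> a b C f) x) y u)" for y
      by (rule linear_dir_deriv2[OF V \<Phi> u])
    have l2: "linear (\<lambda>y. dir_deriv (dir_deriv (plucker_form \<alpha> a b C f) x) y u)" for x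
      by (rule linear_dir_deriv2'[OF V \<Phi> u])
    show "dir_deriv (dir_deriv (plucker_form \<alpha> a b C f) x) y u = 0"
      by (subst expand[OF u, of x], subst expand[OF u, of y])
        (use 0 in \<open>simp add: linear_sum[OF l1] linear_cmul[OF l1] linear_sum[OF l2] linear_cmul[OF l2] hess_def\<close>)
  qed
qed (simp add: hess_def)

text \<open>All frame derivatives of the \<open>h i j\<close> are combinations of the
  \<open>h i j\<close> themselves with smooth coefficients, so the matrix \<open>Y\<close> of these
  functions satisfies the bound required by \<open>vanishes_near_zero\<close>.\<close>

lemma hess_vanishes_near:
  assumes u: "u \<in> V" and zero: "\<And>i j. h i j u = 0"
  obtains \<rho> where "\<rho> > 0" "cball u \<rho> \<subseteq> V" "\<And>v i j. v \<in> cball u \<rho> \<Longrightarrow> h i j v = 0"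
proof -
  obtain r where r: "r > 0" "cball u r \<subseteq> V" using V u open_contains_cball by blast
  let ?N = "cball u r"
  define Y :: "real^3 \<Rightarrow> real^3^3" where "Y v = (\<chi> i j. h i j v)" for v
  have Yij: "Y v $ i $ j = h i j v" for v i j by (simp add: Y_def)
  have sum_smooth: "smooth_on V (\<lambda>v. \<Sum>i\<in>UNIV. \<Sum>j\<in>UNIV. h i j v *\<^sub>R axis i (axis j 1))"
    by (intro smooth_on_sum[OF V] smooth_on_scaleR[OF V] smooth_hess smooth_on_const)
  have "(\<Sum>i\<in>UNIV. \<Sum>j\<in>UNIV. h i j v *\<^sub>R axis i (axis j 1)) = Y v" for v
    by (simp add: vec_eq_iff Y_def sum_3 forall_3 axis_def)
  then have Y: "smooth_on V Y" by (rule smooth_on_cong[OF V _ sum_smooth])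
  \<comment> \<open>This class of functions is closed under sums and under smooth coefficients, so
    membership can be read off from the formulas for \<open>cubic\<close> and
    \<open>D_hess\<close>.\<close>
  define dominated where
    "dominated g \<longleftrightarrow> (\<exists>B\<ge>0. \<forall>v\<in>?N. \<bar>g v\<bar> \<le> B * norm (Y v))" for g :: "real^3 \<Rightarrow> real"
  have dom_h: "dominated (h i j)" for i j
  proof -
    have "\<bar>h i j v\<bar> \<le> 1 * norm (Y v)" for v
      using component_le_norm_cart[of "Y v $ i" j] Finite_Cartesian_Product.norm_nth_le[of "Y v" i] by (simp add: Yij)
    then show ?thesis unfolding dominated_def by (intro exI[of _ 1]) auto
  qed
  have dom_add: "dominated (\<lambda>v. g v + k v)" if "dominated g" "dominated k" for g k
  proof -
    obtain B B' where "B \<ge> 0" "B' \<ge> 0" "\<And>v. v \<in> ?N \<Longrightarrow> \<bar>g v\<bar> \<le> B * norm (Y v)"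
      "\<And>v. v \<in> ?N \<Longrightarrow> \<bar>k v\<bar> \<le> B' * norm (Y v)"
      using \<open>dominated g\<close> \<open>dominated k\<close> unfolding dominated_def by blast
    then have "\<bar>g v + k v\<bar> \<le> (B + B') * norm (Y v)" if "v \<in> ?N" for v
      using that by (smt (verit) distrib_right)
    then show ?thesis unfolding dominated_def using \<open>B \<ge> 0\<close> \<open>B' \<ge> 0\<close> by (intro exI[of _ "B + B'"]) auto
  qed
  note bdd = smooth_on_compact_bound[OF _ compact_cball r(2)]
  have dom_mult: "dominated (\<lambda>v. c v * g v)" if c: "smooth_on V c" and g: "dominated g" for c g
  proof -
    obtain M where M: "M \<ge> 0" "\<And>v. v \<in> ?N \<Longrightarrow> \<bar>c v\<bar> \<le> M" using bdd[OF c] by auto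
    obtain B where B: "B \<ge> 0" "\<And>v. v \<in> ?N \<Longrightarrow> \<bar>g v\<bar> \<le> B * norm (Y v)"
      using g unfolding dominated_def by blast
    have "\<bar>c v * g v\<bar> \<le> (M * B) * norm (Y v)" if "v \<in> ?N" for v
      using mult_mono[OF M(2)[OF that] B(2)[OF that]] M(1) by (simp add: abs_mult mult.assoc)
    then show ?thesis unfolding dominated_def using M(1) B(1) by (intro exI[of _ "M * B"]) auto
  qed
  have dom_cong: "dominated g" if "dominated k" "\<And>v. v \<in> V \<Longrightarrow> g v = k v" for g k
    using that r(2) unfolding dominated_def by (metis subsetD)
  have dom_sum: "dominated (\<lambda>v. \<Sum>n\<in>UNIV. g n v)" if "\<And>n. dominated (g n)" for g :: "3 \<Rightarrow> real^3 \<Rightarrow> real"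
    unfolding sum_3 by (intro dom_add that)
  have dom_diag: "dominated (cubic \<alpha> a b C i i k)" for i k
  proof (rule dom_cong[OF _ cubic_diag])
    show "dominated (\<lambda>v. - 2 * (\<Sum>n\<in>UNIV. \<Gamma> n k i v * h n i v))"
      by (intro dom_mult[OF smooth_on_const] dom_sum dom_mult[OF smooth_Gamma] dom_h)
  qed
  have dom_cubic: "dominated (cubic \<alpha> a b C i j k)" for i j k
  proof -
    consider "i = j" | "i = k" | "j = k" | "i \<noteq> j" "i \<noteq> k" "j \<noteq> k" by blast
    then show ?thesis
    proof cases
      case 1 then show ?thesis using dom_diag by simp
    next
      case 2
      show ?thesis
        by (rule dom_cong[OF dom_diag[of i j]]) (use 2 cubic_commute in metis)
    next
      case 3
      show ?thesis
        by (rule dom_cong[OF dom_diag[of j i]]) (use 3 cubic_commute in metis)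
    next
      case 4
      show ?thesis
        by (rule dom_cong[OF _ cubic_distinct[OF _ 4]])
          (intro dom_add dom_mult smooth_coef dom_h 4; simp add: 4 4[symmetric])+
    qed
  qed
  have dom_D: "dominated (D k (h i j))" for i j k
    by (rule dom_cong[OF _ D_hess]) (intro dom_add dom_cubic dom_sum dom_mult[OF smooth_Gamma] dom_h)
  have "\<exists>K. \<forall>v\<in>?N. \<forall>x. \<bar>dir_deriv (h i j) x v\<bar> \<le> K * norm x * norm (Y v)" for i j
  proof -
    obtain B where B: "\<And>k. B k \<ge> 0" "\<And>k v. v \<in> ?N \<Longrightarrow> \<bar>D k (h i j) v\<bar> \<le> B k * norm (Y v)"
      using dom_D[of _ i j] unfolding dominated_def by metis
    obtain M where M: "\<And>k. M k \<ge> 0" "\<And>k v. v \<in> ?N \<Longrightarrow> norm (\<omega> k v) \<le> M k"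
      using bdd[OF smooth_omega] by metis
    have "\<bar>dir_deriv (h i j) x v\<bar> \<le> (\<Sum>k\<in>UNIV. M k * B k) * norm x * norm (Y v)" if v: "v \<in> ?N" for v x
    proof -
      have vV: "v \<in> V" using v r(2) by blast
      have lin: "linear (\<lambda>x. dir_deriv (h i j) x v)" by (rule linear_dir_deriv1[OF V smooth_hess vV])
      have "dir_deriv (h i j) x v = dir_deriv (h i j) (\<Sum>k\<in>UNIV. (\<omega> k v \<bullet> x) *\<^sub>R \<xi> k v) v"
        using expand[OF vV, of x] by simp
      also have "\<dots> = (\<Sum>k\<in>UNIV. (\<omega> k v \<bullet> x) * D k (h i j) v)"
        by (simp add: linear_sum[OF lin] linear_cmul[OF lin] along_def)
      also have "\<bar>\<dots>\<bar> \<le> (\<Sum>k\<in>UNIV. (M k * norm x) * (B k * norm (Y v)))"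
      proof (rule order_trans[OF sum_abs sum_mono])
        fix k
        have "\<bar>\<omega> k v \<bullet> x\<bar> \<le> M k * norm x"
          using Cauchy_Schwarz_ineq2[of "\<omega> k v" x] mult_right_mono[OF M(2)[OF v, of k], of "norm x"] by simp
        then show "\<bar>(\<omega> k v \<bullet> x) * D k (h i j) v\<bar> \<le> (M k * norm x) * (B k * norm (Y v))"
          unfolding abs_mult using B(2)[OF v, of k] by (intro mult_mono) auto
      qed
      also have "\<dots> = (\<Sum>k\<in>UNIV. M k * B k) * norm x * norm (Y v)"
        unfolding sum_distrib_right by (simp add: ac_simps)
      finally show ?thesis .
    qed
    then show ?thesis by blast
  qed
  then obtain K where K: "\<And>i j v x. v \<in> ?N \<Longrightarrow> \<bar>dir_deriv (h i j) x v\<bar> \<le> K i j * norm x * norm (Y v)" by metis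
  have "norm (dir_deriv Y x v) \<le> (\<Sum>i\<in>UNIV. \<Sum>j\<in>UNIV. K i j) * norm x * norm (Y v)" if v: "v \<in> ?N" for v x
  proof -
    have "dir_deriv Y x v $ i $ j = dir_deriv (h i j) x v" for i j
      using dir_deriv_linear_comp[OF bounded_linear_compose[OF bounded_linear_vec_nth bounded_linear_vec_nth]
          smooth_on_differentiable[OF Y], of v i j x] v r(2) by (auto simp: Yij)
    then have "norm (dir_deriv Y x v) \<le> (\<Sum>i\<in>UNIV. \<Sum>j\<in>UNIV. \<bar>dir_deriv (h i j) x v\<bar>)"
      using norm_matrix_le_sum[of "dir_deriv Y x v"] by simp
    also have "\<dots> \<le> (\<Sum>i\<in>UNIV. \<Sum>j\<in>UNIV. K i j * norm x * norm (Y v))"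
      by (intro sum_mono K v)
    finally show ?thesis by (simp add: sum_distrib_right)
  qed
  moreover have "Y u = 0" using zero by (simp add: Y_def vec_eq_iff)
  ultimately obtain \<rho> where "\<rho> > 0" "cball u \<rho> \<subseteq> V" "\<And>v. v \<in> cball u \<rho> \<Longrightarrow> Y v = 0"
    using vanishes_near_zero[OF Y r] by blast
  then show thesis using that Yij by (metis zero_index)
qed

end

end

section \<open>Propagation over the connected domain\<close>

text \<open>The set \<open>Z\<close> where the second derivative vanishes is open by unique
  continuation, and so is its complement \<open>N\<close> in \<open>U\<close> by continuity;
  connectedness gives \<open>Z = U\<close>. Two integrations from \<open>u0\<close> then give the
  claim.\<close>

lemma plucker_form_vanishes:
  fixes f :: "real^3 \<Rightarrow> real^3"
  assumes U: "open U" "connected U" and T: "T_system_on U f" and u0: "u0 \<in> U"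
    and 0: "plucker_form \<alpha> a b C f u0 = 0" "\<And>x. dir_deriv (plucker_form \<alpha> a b C f) x u0 = 0"
      "\<And>x y. dir_deriv (dir_deriv (plucker_form \<alpha> a b C f) x) y u0 = 0"
    and u: "u \<in> U"
  shows "plucker_form \<alpha> a b C f u = 0"
proof -
  let ?\<Phi> = "plucker_form \<alpha> a b C f"
  have \<Phi>: "smooth_on U ?\<Phi>"
    using smooth_plucker_form[OF U(1)] T by (simp add: T_system_on_def)
  define Z where "Z = {u\<in>U. \<forall>x y. dir_deriv (dir_deriv ?\<Phi> x) y u = 0}"
  define N where "N = (\<Union>x y. U \<inter> dir_deriv (dir_deriv ?\<Phi> x) y -` (- {0}))"
  have "open Z"
    unfolding open_contains_ball
  proof
    fix v assume v: "v \<in> Z"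
    then have "v \<in> U" by (simp add: Z_def)
    obtain V lam \<xi> \<omega> where F: "v \<in> V" "V \<subseteq> U" "T_frame V f lam \<xi> \<omega>"
      by (rule T_frame_exists[OF U(1) T \<open>v \<in> U\<close>])
    interpret T_frame V f lam \<xi> \<omega> by (rule F(3))
    have "\<And>i j. hess \<alpha> a b C i j v = 0" using hess_zero_iff[OF F(1), of \<alpha> a b C] v by (simp add: Z_def)
    then obtain \<rho> where \<rho>: "\<rho> > 0" "cball v \<rho> \<subseteq> V" "\<And>w i j. w \<in> cball v \<rho> \<Longrightarrow> hess \<alpha> a b C i j w = 0"
      using hess_vanishes_near[OF F(1)] by metis
    have "w \<in> Z" if "w \<in> ball v \<rho>" for w
    proof -
      have "w \<in> cball v \<rho>" using that by simp
      then show ?thesis using hess_zero_iff[of w \<alpha> a b C] \<rho>(2,3) F(2) by (auto simp: Z_def)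
    qed
    then show "\<exists>e>0. ball v e \<subseteq> Z" using \<rho>(1) by blast
  qed
  moreover have "open N"
    unfolding N_def
  proof (intro open_UN ballI)
    fix x y
    show "open (U \<inter> dir_deriv (dir_deriv ?\<Phi> x) y -` (- {0}))"
      by (rule continuous_open_preimage[OF smooth_on_continuous_on[OF smooth_on_dir_deriv[OF smooth_on_dir_deriv[OF \<Phi>]]] U(1)])
        auto
  qed
  moreover have "Z \<inter> N \<inter> U = {}" "U \<subseteq> Z \<union> N" "Z \<inter> U \<noteq> {}"
    using u0 0(3) by (auto simp: Z_def N_def)
  ultimately have "N \<inter> U = {}" using connectedD[OF U(2), of Z N] by blast
  then have D2: "dir_deriv (dir_deriv ?\<Phi> x) y v = 0" if "v \<in> U" for x y v
    using that by (auto simp: N_def)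
  have D1: "dir_deriv ?\<Phi> x v = 0" if "v \<in> U" for x v
  proof -
    have "dir_deriv ?\<Phi> x v = dir_deriv ?\<Phi> x u0"
      by (rule has_derivative_zero_unique_connected[OF U _ that u0])
        (use has_derivative_dir_deriv[OF smooth_on_differentiable[OF smooth_on_dir_deriv[OF \<Phi>]]] in \<open>simp add: D2\<close>)
    then show ?thesis by (simp add: 0)
  qed
  have "?\<Phi> u = ?\<Phi> u0"
    by (rule has_derivative_zero_unique_connected[OF U _ u u0])
      (use has_derivative_dir_deriv[OF smooth_on_differentiable[OF \<Phi>]] in \<open>simp add: D1\<close>)
  then show ?thesis by (simp add: 0)
qed

section \<open>Dimension count and conclusion\<close>

text \<open>The span of \<open>A\<close> has dimension at most \<open>length A\<close>, so its
  orthogonal complement has dimension at least 3. Dependencies or repetitions in the list only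
  enlarge the complement.\<close>

lemma exists_orthogonal_triple:
  fixes A :: "'a::euclidean_space list"
  assumes "length A + 3 \<le> DIM('a)"
  obtains E where "independent E" "card E = 3" "\<And>x y. x \<in> set A \<Longrightarrow> y \<in> E \<Longrightarrow> y \<bullet> x = 0"
proof -
  define N where "N = {y \<in> UNIV. \<forall>x\<in>span (set A). orthogonal x y}"
  have "dim N + dim (span (set A)) = DIM('a)"
    using dim_subspace_orthogonal_to_vectors[of "span (set A)" UNIV] by (simp add: N_def)
  moreover have "dim (span (set A)) \<le> length A"
    using dim_le_card'[of "set A"] card_length[of A] by simp
  ultimately have "dim N \<ge> 3" using assms by simp
  obtain B where B: "B \<subseteq> N" "independent B" "N \<subseteq> span B" "card B = dim N"
    by (rule basis_exists[of N])
  from \<open>dim N \<ge> 3\<close> have "3 \<le> card B" using B(4) by simp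
  then obtain E where E: "E \<subseteq> B" "card E = 3"
    by (rule obtain_subset_with_card_n)
  show thesis
  proof (rule that[OF independent_mono[OF B(2) E(1)] E(2)])
    fix x y assume "x \<in> set A" "y \<in> E"
    then have "orthogonal x y" using E(1) B(1) span_base[of x "set A"] by (auto simp: N_def)
    then show "y \<bullet> x = 0" by (simp add: orthogonal_def inner_commute)
  qed
qed

lemma inner_plucker_coords:
  "(\<alpha>, a, b, C) \<bullet> plucker_coords f u = plucker_form \<alpha> a b C f u"
  by (simp add: plucker_coords_def plucker_form_def wedge_def inner_prod_def)

lemma linear_congruence_onI:
  fixes f :: "real^'n \<Rightarrow> real^'n"
  assumes "independent E" "card E = CARD('n)"
    and "\<And>\<alpha> a b C. (\<alpha>, a, b, C) \<in> E \<Longrightarrow> transpose C = - C \<and> (\<forall>u\<in>U. plucker_form \<alpha> a b C f u = 0)"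
  shows "linear_congruence_on U f"
  unfolding linear_congruence_on_def using assms
  by (intro exI[of _ E] conjI) (auto simp: plucker_coords_def plucker_form_def wedge_def inner_vec_def)

theorem theorem8:
  fixes f :: "real^3 \<Rightarrow> real^3" and U :: "(real^3) set"
  assumes "open U" and "connected U" and "T_system_on U f"
  shows "linear_congruence_on U f"
proof (cases "U = {}")
  case True
  \<comment> \<open>On an empty domain any three independent covectors with skew matrix part will
    do.\<close>
  let ?E = "(\<lambda>b. (0, b, 0, 0)) ` Basis :: (real \<times> (real^3) \<times> (real^3) \<times> (real^3^3)) set"
  have "?E \<subseteq> Basis" by (auto simp: Basis_prod_def image_iff zero_prod_def)
  then have "independent ?E" by (rule independent_mono[OF independent_Basis])
  moreover have "card ?E = 3" by (subst card_image) (auto simp: inj_on_def)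
  moreover have "transpose 0 = - (0 :: real^3^3)" by (simp add: transpose_def vec_eq_iff)
  ultimately show ?thesis
    using True by (intro linear_congruence_onI[of ?E]) auto
next
  case False
  then obtain u0 where u0: "u0 \<in> U" by blast
  have f: "smooth_on U f" using assms(3) by (simp add: T_system_on_def)
  obtain V lam \<xi> \<omega> where F: "u0 \<in> V" "V \<subseteq> U" "T_frame V f lam \<xi> \<omega>"
    by (rule T_frame_exists[OF assms(1,3) u0])
  interpret T_frame V f lam \<xi> \<omega> by (rule F(3))
  \<comment> \<open>\<open>p1\<close> and \<open>p2\<close> are the first and second derivatives of
    \<open>plucker_coords f\<close> at \<open>u0\<close>, in directions \<open>x\<close> and
    \<open>\<xi> i u0\<close>, \<open>\<xi> j u0\<close>. Orthogonality to the matrices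
    \<open>sy\<close> makes \<open>C\<close> skew.\<close>
  define p1 :: "real^3 \<Rightarrow> real \<times> (real^3) \<times> (real^3) \<times> (real^3^3)" where
    "p1 x = (0, x, dir_deriv f x u0, wedge x (f u0) + wedge u0 (dir_deriv f x u0))" for x
  define p2 :: "3 \<Rightarrow> 3 \<Rightarrow> real \<times> (real^3) \<times> (real^3) \<times> (real^3^3)" where
    "p2 i j = (0, 0, Q i j u0, wedge u0 (Q i j u0) + (lam j u0 - lam i u0) *\<^sub>R wedge (\<xi> i u0) (\<xi> j u0))" for i j
  define sy :: "3 \<Rightarrow> 3 \<Rightarrow> real \<times> (real^3) \<times> (real^3) \<times> (real^3^3)" where
    "sy i j = (0, 0, 0, axis i (axis j 1) + axis j (axis i 1))" for i j
  \<comment> \<open>The ambient space has dimension 1 + 3 + 3 + 9 = 16, since matrices are stored in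
    full. The list has 7 conditions on the 2-jet and 6 on the symmetric part of \<open>C\<close>,
    which leaves 3 dimensions.\<close>
  let ?A = "[plucker_coords f u0, p1 (\<xi> 1 u0), p1 (\<xi> 2 u0), p1 (\<xi> 3 u0), p2 1 2, p2 1 3, p2 2 3,
    sy 1 1, sy 2 2, sy 3 3, sy 1 2, sy 1 3, sy 2 3]"
  obtain E where E: "independent E" "card E = 3" "\<And>x y. x \<in> set ?A \<Longrightarrow> y \<in> E \<Longrightarrow> y \<bullet> x = 0"
    using exists_orthogonal_triple[of ?A] by auto
  have "transpose C = - C \<and> (\<forall>u\<in>U. plucker_form \<alpha> a b C f u = 0)" if "(\<alpha>, a, b, C) \<in> E" for \<alpha> a b C
  proof
    let ?\<Phi> = "plucker_form \<alpha> a b C f"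
    note orth = E(3)[OF _ that]
    have sy: "C $ i $ j + C $ j $ i = 0" if "sy i j \<in> set ?A" for i j
      using orth[OF that] by (simp add: sy_def inner_prod_def inner_add_right inner_axis)
    have skew: "C $ j $ i = - C $ i $ j" for i j
      using sy[of 1 1] sy[of 2 2] sy[of 3 3] sy[of 1 2] sy[of 1 3] sy[of 2 3] exhaust_3[of i] exhaust_3[of j]
      by auto
    show "transpose C = - C"
      unfolding vec_eq_iff transpose_def vec_lambda_beta vector_uminus_component by (intro allI skew)
    have form: "?\<Phi> u0 = 0" using orth[of "plucker_coords f u0"] by (simp add: inner_plucker_coords)
    have "dir_deriv ?\<Phi> (\<xi> i u0) u0 = 0" for i
    proof -
      have "(\<alpha>, a, b, C) \<bullet> p1 (\<xi> i u0) = 0" by (rule orth) (use exhaust_3[of i] in auto)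
      then show ?thesis
        by (simp add: plucker_form_deriv1[OF assms(1) f u0] p1_def inner_prod_def inner_add_right)
    qed
    moreover have lin: "linear (\<lambda>x. dir_deriv ?\<Phi> x u0)"
      by (rule linear_dir_deriv1[OF assms(1) smooth_plucker_form[OF assms(1) f] u0])
    ultimately have deriv1: "dir_deriv ?\<Phi> x u0 = 0" for x
      by (subst expand[OF F(1), of x]) (simp add: linear_sum[OF lin] linear_cmul[OF lin])
    have hess: "hess \<alpha> a b C i j u0 = (\<alpha>, a, b, C) \<bullet> p2 i j" for i j
      by (simp add: hess_eq[OF F(1)] p2_def inner_prod_def inner_add_right)
    have "hess \<alpha> a b C 1 2 u0 = 0" "hess \<alpha> a b C 1 3 u0 = 0" "hess \<alpha> a b C 2 3 u0 = 0"
      unfolding hess by (rule orth, simp)+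
    \<comment> \<open>The diagonal entries vanish by \<open>hess_diag\<close>, which is why three
      second-order conditions suffice.\<close>
    then have "hess \<alpha> a b C i j u0 = 0" for i j
      using exhaust_3[of i] exhaust_3[of j] hess_commute[OF F(1), of \<alpha> a b C 2 1]
        hess_commute[OF F(1), of \<alpha> a b C 3 1] hess_commute[OF F(1), of \<alpha> a b C 3 2]
      by (elim disjE) (simp_all add: hess_diag[OF F(1)])
    then have "dir_deriv (dir_deriv ?\<Phi> x) y u0 = 0" for x y
      using hess_zero_iff[OF F(1)] by blast
    then show "\<forall>u\<in>U. ?\<Phi> u = 0"
      using plucker_form_vanishes[OF assms u0 form deriv1] by blast
  qed
  with E(1,2) show ?thesis by (intro linear_congruence_onI[of E]) simp_all
qed

end
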